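(* Let $p\in[0,1)$ and $q=2p-1\in[-1,1)$. There exists a zero-mean martingale $(\Xi_n)_{n\ge0}$ adapted to $(\mathcal F_n)_{n\ge0}$, with bounded increments and with predictable quadratic variation $\langle\Xi\rangle_n=\sum_{k=1}^n\mathbb E[(\Xi_k-\Xi_{k-1})^2\mid\mathcal F_{k-1}]$ satisfying $\langle\Xi\rangle_n/n\to1$ almost surely, such that for all $n\ge 0$ $$\Delta^{(s)}_n=\Xi_n+q\sum_{k=1}^{n-1}(-1)^k\frac{W_k}{k}.$$ Moreover the predictable process $Z_n:=\Delta^{(s)}_n-\Xi_n$ converges almost surely and in $L^2$ to the zero-mean random variable $Z_\infty:=q\sum_{k=1}^\infty(-1)^k\frac{W_k}{k}$, whose second moment is $$\mathbb E[Z_\infty^2]=\begin{cases}\dfrac{q^2}{2q-1}\displaystyle\int_0^1\frac{u^{-2q+1}-1}{1-u}\cdot\frac{(1-\frac u2)^{q-1}-1}{u}\,du & q\neq\tfrac12,\\[8pt] \dfrac14\displaystyle\int_0^1\frac{-\ln u}{1-u}\cdot\frac{(1-\frac u2)^{-1/2}-1}{u}\,du & q=\tfrac12.\end{cases}$$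
   Context: Let $D_\infty=\langle a,b\mid a^2=e,\ b^2=e\rangle$ be the infinite dihedral group (its Cayley graph with respect to $\{a,b\}$ is the bi-infinite path). Fix a memory parameter $p\in[0,1]$ and set $q=2p-1$. The elephant random walk (ERW) on $D_\infty$ has steps $g_1,g_2,\dots\in\{a,b\}$ defined as follows: $g_1$ is uniform on $\{a,b\}$; with $\mathcal F_n=\sigma(g_1,\dots,g_n)$ ($\mathcal F_0$ trivial), given $\mathcal F_n$ ($n\ge1$) pick $I_{n+1}$ uniform on $\{1,\dots,n\}$ and set $g_{n+1}=g_{I_{n+1}}$ with probability $p$ and $g_{n+1}=$ the other generator (i.e. $b$ if $g_{I_{n+1}}=a$, $a$ if $g_{I_{n+1}}=b$) with probability $1-p$. Equivalently, if $A_n,B_n$ denote the numbers of $a$-steps and $b$-steps among $g_1,\dots,g_n$, then $\mathbb P(g_{n+1}=a\mid\mathcal F_n)=\frac{pA_n+(1-p)B_n}{n}$. The position is $w_0=e$ and $w_n$ = the reduced word of $g_ng_{n-1}\cdots g_1$ (reduced using $a^2=b^2=e$); $\Delta_n$ is the length of $w_n$. The signed location is $\Delta^{(s)}_n=\Delta_n$ if $w_n=e$ or the rightmost letter of the reduced word $w_n$ is $a$, and $\Delta^{(s)}_n=-\Delta_n$ if its rightmost letter is $b$ (so $a,ba,aba,\dots$ sit at $1,2,3,\dots$ and $b,ab,bab,\dots$ at $-1,-2,-3,\dots$). Finally $W_0=0$ and $W_n=A_n-B_n$ (this is the classical elephant random walk on $\mathbb Z$). *)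

theory Defs
  imports "HOL-Probability.Probability"
begin

text \<open>Generators of D_infinity are encoded as booleans: True = a, False = b.
  Steps are g 1, g 2, ... (g 0 is unused).\<close>

text \<open>Left multiplication of a reduced word (list, leftmost letter first) by a generator,
  reducing with a^2 = b^2 = e.\<close>
fun mul_gen :: "bool \<Rightarrow> bool list \<Rightarrow> bool list" where
  "mul_gen x [] = [x]"
| "mul_gen x (y # ys) = (if x = y then ys else x # y # ys)"

primrec erw_word :: "(nat \<Rightarrow> 'a \<Rightarrow> bool) \<Rightarrow> nat \<Rightarrow> 'a \<Rightarrow> bool list" where
  "erw_word g 0 \<omega> = []"
| "erw_word g (Suc n) \<omega> = mul_gen (g (Suc n) \<omega>) (erw_word g n \<omega>)"

definition signed_loc :: "bool list \<Rightarrow> real" where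
  "signed_loc w = (if w = [] \<or> last w then real (length w) else - real (length w))"

definition Delta_s :: "(nat \<Rightarrow> 'a \<Rightarrow> bool) \<Rightarrow> nat \<Rightarrow> 'a \<Rightarrow> real" where
  "Delta_s g n \<omega> = signed_loc (erw_word g n \<omega>)"

definition A_cnt :: "(nat \<Rightarrow> 'a \<Rightarrow> bool) \<Rightarrow> nat \<Rightarrow> 'a \<Rightarrow> real" where
  "A_cnt g n \<omega> = real (card {k \<in> {1..n}. g k \<omega>})"

definition B_cnt :: "(nat \<Rightarrow> 'a \<Rightarrow> bool) \<Rightarrow> nat \<Rightarrow> 'a \<Rightarrow> real" where
  "B_cnt g n \<omega> = real (card {k \<in> {1..n}. \<not> g k \<omega>})"

definition W_erw :: "(nat \<Rightarrow> 'a \<Rightarrow> bool) \<Rightarrow> nat \<Rightarrow> 'a \<Rightarrow> real" where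
  "W_erw g n \<omega> = A_cnt g n \<omega> - B_cnt g n \<omega>"

definition erw_filt :: "'a measure \<Rightarrow> (nat \<Rightarrow> 'a \<Rightarrow> bool) \<Rightarrow> nat \<Rightarrow> 'a measure" where
  "erw_filt M g n = sigma (space M) {{\<omega> \<in> space M. g k \<omega>} | k. k \<in> {1..n}}"

definition is_martingale :: "'a measure \<Rightarrow> (nat \<Rightarrow> 'a measure) \<Rightarrow> (nat \<Rightarrow> 'a \<Rightarrow> real) \<Rightarrow> bool" where
  "is_martingale M F X \<longleftrightarrow>
     (\<forall>n. integrable M (X n) \<and> X n \<in> borel_measurable (F n) \<and>
          (\<forall>A \<in> sets (F n). (LINT \<omega>:A|M. X (Suc n) \<omega>) = (LINT \<omega>:A|M. X n \<omega>)))"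

definition pred_qv :: "'a measure \<Rightarrow> (nat \<Rightarrow> 'a measure) \<Rightarrow> (nat \<Rightarrow> 'a \<Rightarrow> real) \<Rightarrow> nat \<Rightarrow> 'a \<Rightarrow> real" where
  "pred_qv M F X n \<omega> =
     (\<Sum>k\<in>{1..n}. real_cond_exp M (F (k - 1)) (\<lambda>x. (X k x - X (k - 1) x)\<^sup>2) \<omega>)"

end

theory Submission
  imports Defs
begin

text \<open>
  Write \<open>\<epsilon>\<^sub>k = \<plusminus>1\<close> for the sign of step \<open>k\<close>, \<open>c\<^sub>n = W\<^sub>n / n\<close> and \<open>d\<^sub>n = \<epsilon>\<^bsub>n+1\<^esub> - q c\<^sub>n\<close>, which is a
  martingale difference. The parity of the location equals that of the time, so
  \<open>\<Delta>\<^sup>(\<^sup>s\<^sup>)\<^sub>n = \<Sum>\<^bsub>k<n\<^esub> (-1)\<^sup>k \<epsilon>\<^bsub>k+1\<^esub>\<close>, and \<open>\<Xi>\<^sub>n = \<Sum>\<^bsub>k<n\<^esub> (-1)\<^sup>k d\<^sub>k\<close> is the martingale part.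

  Since \<open>c\<^bsub>n+1\<^esub> = (n+q)/(n+1) c\<^sub>n + d\<^sub>n/(n+1)\<close>, the expectations of \<open>c\<^sub>n\<^sup>2/(n+1)\<close> are summable; as
  \<open>c\<^sub>n\<close> varies by at most \<open>2/(n+1)\<close> per step, \<open>c\<^sub>n \<rightarrow> 0\<close> almost surely.

  If \<open>H\<^sub>n = 1 - (n+q)/(n+1) H\<^bsub>n+1\<^esub>\<close>, then \<open>(\<Sum>\<^bsub>k<n\<^esub> (-1)\<^sup>k c\<^sub>k) + (-1)\<^sup>n H\<^sub>n c\<^sub>n\<close> is a martingale with increments
  \<open>(-1)\<^bsup>n+1\<^esup> H\<^bsub>n+1\<^esub> d\<^sub>n/(n+1)\<close>. For bounded \<open>H\<close> these have summable variances, so by Kolmogorov's maximal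
  inequality the martingale converges almost surely and in \<open>L\<^sup>2\<close>, with limit \<open>Z\<^sub>\<infinity>/q\<close> and second moment
  \<open>\<Sum> E[c\<^sub>k\<^sup>2] (2H\<^sub>k - 1)\<close>. The bounded solution has
  \<open>2H\<^sub>k - 1 = \<integral> k (1-u)\<^bsup>k-1\<^esup> ((1-u/2)\<^bsup>q-1\<^esup> - 1) du\<close> over \<open>[0,1]\<close>, and exchanging sum and integral leaves the
  generating function of \<open>k E[c\<^sub>k\<^sup>2]\<close>, which is elementary.
\<close>

section \<open>Real sequences\<close>

lemma summable_inverse_Suc_squares: "summable (\<lambda>n. 1 / (real n + 1)\<^sup>2)"
  using summable_Suc_iff[of "\<lambda>n. inverse ((real n)\<^sup>2)"] inverse_power_summable[of 2, where 'a = real]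
  by (simp add: field_simps)

lemma suminf_tail_tendsto_0:
  fixes f :: "nat \<Rightarrow> 'a::real_normed_vector"
  assumes "summable f"
  shows "(\<lambda>m. \<Sum>k. f (k + m)) \<longlonglongrightarrow> 0"
  using tendsto_diff[OF tendsto_const summable_LIMSEQ[OF assms], of "suminf f"]
  by (simp add: suminf_minus_initial_segment[OF assms])

lemma summable_of_small_block_sums:
  fixes f :: "nat \<Rightarrow> 'a::banach"
  assumes small: "\<And>j. \<exists>m. \<forall>k. norm (\<Sum>i<k. f (i + m)) < inverse (real (Suc j))"
  shows "summable f"
  unfolding summable_iff_convergent Cauchy_convergent_iff[symmetric] Cauchy_altdef2
proof (intro allI impI)
  fix e :: real assume "0 < e"
  then obtain j where j: "inverse (real (Suc j)) < e"
    using reals_Archimedean by blast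
  obtain m where m: "\<And>k. norm (\<Sum>i<k. f (i + m)) < inverse (real (Suc j))"
    using small by blast
  have "dist (sum f {..<n}) (sum f {..<m}) < e" if "m \<le> n" for n
    using m[of "n - m"] j sum_diff_nat_ivl[of 0 m n f] that
    by (simp add: dist_norm lessThan_atLeast0 sum.atLeastLessThan_shift_0[of _ m n] o_def add.commute)
  then show "\<exists>N. \<forall>n\<ge>N. dist (sum f {..<n}) (sum f {..<N}) < e"
    by blast
qed

lemma Cesaro_tendsto:
  fixes f :: "nat \<Rightarrow> 'a::real_normed_vector"
  assumes "f \<longlonglongrightarrow> L"
  shows "(\<lambda>n. (\<Sum>k<n. f k) /\<^sub>R real n) \<longlonglongrightarrow> L"
proof (rule tendstoI)
  fix e :: real assume "0 < e"
  then obtain N where N: "\<And>k. k \<ge> N \<Longrightarrow> norm (f k - L) < e / 2"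
    using LIMSEQ_D[OF assms, of "e / 2"] by auto
  define C where "C = (\<Sum>k<N. norm (f k - L))"
  have "(\<lambda>n. C / real n) \<longlonglongrightarrow> 0"
    by (rule lim_const_over_n)
  then have "\<forall>\<^sub>F n in sequentially. C / real n < e / 2"
    using \<open>0 < e\<close> by (intro order_tendstoD(2)) auto
  then show "\<forall>\<^sub>F n in sequentially. dist ((\<Sum>k<n. f k) /\<^sub>R real n) L < e"
    using eventually_gt_at_top[of 0] eventually_ge_at_top[of N]
  proof eventually_elim
    case (elim n)
    have "norm (\<Sum>k<n. f k - L) \<le> (\<Sum>k<n. norm (f k - L))"
      by (rule norm_sum)
    also have "\<dots> = C + (\<Sum>k=N..<n. norm (f k - L))"
      using elim(3) unfolding C_def by (simp add: lessThan_atLeast0 sum.atLeastLessThan_concat)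
    also have "\<dots> \<le> C + (\<Sum>k=N..<n. e / 2)"
      using N by (intro add_left_mono sum_mono less_imp_le) auto
    also have "\<dots> \<le> C + real n * (e / 2)"
      using \<open>0 < e\<close> by simp
    finally have "norm (\<Sum>k<n. f k - L) / real n \<le> C / real n + e / 2"
      using elim(2) by (simp add: field_simps)
    moreover have "dist ((\<Sum>k<n. f k) /\<^sub>R real n) L = norm (\<Sum>k<n. f k - L) / real n"
    proof -
      have "(\<Sum>k<n. f k) /\<^sub>R real n - L = (\<Sum>k<n. f k - L) /\<^sub>R real n"
        using elim(2) by (simp add: sum_subtractf scaleR_diff_right sum_constant_scaleR)
      then show ?thesis
        by (simp only: dist_norm norm_scaleR divide_inverse_commute abs_inverse abs_of_nat)
    qed
    ultimately show ?case
      using elim(1) by linarith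
  qed
qed

lemma not_summable_divide_Suc_of_pos_limit:
  fixes x :: "nat \<Rightarrow> real"
  assumes lim: "x \<longlonglongrightarrow> l" and "0 < l"
  shows "\<not> summable (\<lambda>n. x n / (real n + 1))"
proof
  assume summ: "summable (\<lambda>n. x n / (real n + 1))"
  have "\<forall>\<^sub>F n in sequentially. l / 2 < x n"
    using \<open>0 < l\<close> by (intro order_tendstoD(1)[OF lim]) simp
  then have "\<forall>\<^sub>F n in sequentially. norm (l / 2 * inverse (real (Suc n))) \<le> x n / (real n + 1)"
  proof eventually_elim
    case (elim n)
    then have "l / 2 / (real n + 1) \<le> x n / (real n + 1)"
      by (intro divide_right_mono) auto
    moreover have "norm (l / 2 * inverse (real (Suc n))) = l / 2 / (real n + 1)"
      using \<open>0 < l\<close> by (simp add: abs_mult field_simps)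
    ultimately show ?case
      by (simp only:)
  qed
  then have "summable (\<lambda>n. l / 2 * inverse (real (Suc n)))"
    by (rule summable_comparison_test_ev[OF _ summ])
  then have "summable (\<lambda>n. inverse (real (Suc n)))"
    using \<open>0 < l\<close> by (subst (asm) summable_cmult_iff) auto
  then have "summable (\<lambda>n. inverse (real n))"
    by (subst (asm) summable_Suc_iff)
  then show False
    using not_summable_harmonic[where 'a = real] by simp
qed

text \<open>The increments of \<open>x\<^sup>2\<close> are absolutely summable, so \<open>x\<close> has a limit, which the harmonic series forces to be 0.\<close>

lemma slowly_varying_tendsto_zero:
  fixes x :: "nat \<Rightarrow> real"
  assumes nonneg: "\<And>n. 0 \<le> x n"
    and slow: "\<And>n. \<bar>x (Suc n) - x n\<bar> \<le> K / (real n + 1)"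
    and summ: "summable (\<lambda>n. x n / (real n + 1))"
  shows "x \<longlonglongrightarrow> 0"
proof -
  have "0 \<le> K"
    using order_trans[OF abs_ge_zero slow[of 0]] by simp
  have bound: "norm ((x (Suc n))\<^sup>2 - (x n)\<^sup>2) \<le> 2 * K * (x n / (real n + 1)) + K\<^sup>2 * (1 / (real n + 1)\<^sup>2)" for n
  proof -
    have "norm ((x (Suc n))\<^sup>2 - (x n)\<^sup>2) = \<bar>x (Suc n) - x n\<bar> * (x (Suc n) + x n)"
      using nonneg[of n] nonneg[of "Suc n"] by (simp add: power2_eq_square square_diff_square_factored abs_mult)
    also have "\<dots> \<le> K / (real n + 1) * (2 * x n + K / (real n + 1))"
      using slow[of n] nonneg[of n] nonneg[of "Suc n"] \<open>0 \<le> K\<close> by (intro mult_mono) auto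
    also have "\<dots> = 2 * K * (x n / (real n + 1)) + K\<^sup>2 * (1 / (real n + 1)\<^sup>2)"
      by (simp add: power2_eq_square algebra_simps)
    finally show ?thesis .
  qed
  have "summable (\<lambda>n. (x (Suc n))\<^sup>2 - (x n)\<^sup>2)"
    by (rule summable_comparison_test'[OF _ bound])
       (intro summable_add summable_mult summ summable_inverse_Suc_squares)
  then have "convergent (\<lambda>n. (x n)\<^sup>2)"
    unfolding summable_iff_convergent
    by (simp add: sum_lessThan_telescope[of "\<lambda>n. (x n)\<^sup>2"] convergent_diff_const_right_iff)
  then obtain L where "(\<lambda>n. (x n)\<^sup>2) \<longlonglongrightarrow> L"
    by (auto simp: convergent_def)
  then have "(\<lambda>n. sqrt ((x n)\<^sup>2)) \<longlonglongrightarrow> sqrt L"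
    by (rule tendsto_real_sqrt)
  then have lim: "x \<longlonglongrightarrow> sqrt L"
    using nonneg by simp
  moreover have "0 \<le> sqrt L"
    using nonneg by (intro LIMSEQ_le_const[OF lim]) auto
  moreover have "\<not> 0 < sqrt L"
    using not_summable_divide_Suc_of_pos_limit[OF lim] summ by blast
  ultimately show ?thesis
    by simp
qed

section \<open>Square-integrable functions\<close>

lemma integrable_mult_of_square_integrable:
  fixes f g :: "'a \<Rightarrow> real"
  assumes [measurable]: "f \<in> borel_measurable M" "g \<in> borel_measurable M"
    and "integrable M (\<lambda>x. (f x)\<^sup>2)" "integrable M (\<lambda>x. (g x)\<^sup>2)"
  shows "integrable M (\<lambda>x. f x * g x)"
proof (rule Bochner_Integration.integrable_bound)
  show "integrable M (\<lambda>x. (f x)\<^sup>2 + (g x)\<^sup>2)"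
    using assms by simp
  have "\<bar>f x * g x\<bar> \<le> (f x)\<^sup>2 + (g x)\<^sup>2" for x
    using sum_squares_bound[of "\<bar>f x\<bar>" "\<bar>g x\<bar>"] abs_ge_zero[of "f x * g x"]
    unfolding abs_mult power2_abs by linarith
  then show "AE x in M. norm (f x * g x) \<le> norm ((f x)\<^sup>2 + (g x)\<^sup>2)"
    by simp
qed measurable

lemma square_integrable_add:
  fixes f g :: "'a \<Rightarrow> real"
  assumes "f \<in> borel_measurable M" "g \<in> borel_measurable M"
    and "integrable M (\<lambda>x. (f x)\<^sup>2)" "integrable M (\<lambda>x. (g x)\<^sup>2)"
  shows "integrable M (\<lambda>x. (f x + g x)\<^sup>2)"
  using assms integrable_mult_of_square_integrable[OF assms] by (simp add: power2_sum mult.assoc)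

lemma square_integrable_diff:
  fixes f g :: "'a \<Rightarrow> real"
  assumes "f \<in> borel_measurable M" "g \<in> borel_measurable M"
    and "integrable M (\<lambda>x. (f x)\<^sup>2)" "integrable M (\<lambda>x. (g x)\<^sup>2)"
  shows "integrable M (\<lambda>x. (f x - g x)\<^sup>2)"
  using square_integrable_add[of f M "\<lambda>x. - g x"] assms by simp

lemma Cauchy_Schwarz_integral:
  fixes f g :: "'a \<Rightarrow> real"
  assumes [measurable]: "f \<in> borel_measurable M" "g \<in> borel_measurable M"
    and f: "integrable M (\<lambda>x. (f x)\<^sup>2)" and g: "integrable M (\<lambda>x. (g x)\<^sup>2)"
  shows "(\<integral>x. f x * g x \<partial>M)\<^sup>2 \<le> (\<integral>x. (f x)\<^sup>2 \<partial>M) * (\<integral>x. (g x)\<^sup>2 \<partial>M)"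
proof -
  have "ennreal ((\<integral>x. \<bar>f x * g x\<bar> \<partial>M)\<^sup>2) = (\<integral>\<^sup>+x. ennreal \<bar>f x * g x\<bar> \<partial>M)\<^sup>2"
    using f g by (simp add: nn_integral_eq_integral integrable_mult_of_square_integrable ennreal_power)
  also have "\<dots> \<le> (\<integral>\<^sup>+x. (ennreal \<bar>f x\<bar>)\<^sup>2 \<partial>M) * (\<integral>\<^sup>+x. (ennreal \<bar>g x\<bar>)\<^sup>2 \<partial>M)"
    using Cauchy_Schwarz_nn_integral[of "\<lambda>x. ennreal \<bar>f x\<bar>" M "\<lambda>x. ennreal \<bar>g x\<bar>"]
    by (simp add: abs_mult ennreal_mult)
  also have "\<dots> = ennreal ((\<integral>x. (f x)\<^sup>2 \<partial>M) * (\<integral>x. (g x)\<^sup>2 \<partial>M))"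
    using f g by (simp add: nn_integral_eq_integral ennreal_power ennreal_mult)
  finally have "(\<integral>x. \<bar>f x * g x\<bar> \<partial>M)\<^sup>2 \<le> (\<integral>x. (f x)\<^sup>2 \<partial>M) * (\<integral>x. (g x)\<^sup>2 \<partial>M)"
    by (subst (asm) ennreal_le_iff) auto
  moreover have "(\<integral>x. f x * g x \<partial>M)\<^sup>2 \<le> (\<integral>x. \<bar>f x * g x\<bar> \<partial>M)\<^sup>2"
    using power_mono[OF integral_abs_bound[of M "\<lambda>x. f x * g x"], of 2] by simp
  ultimately show ?thesis
    by simp
qed

lemma tendsto_integral_mult_of_L2:
  fixes h L :: "'a \<Rightarrow> real" and Y :: "nat \<Rightarrow> 'a \<Rightarrow> real"
  assumes [measurable]: "h \<in> borel_measurable M" "L \<in> borel_measurable M" "\<And>n. Y n \<in> borel_measurable M"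
    and sq: "integrable M (\<lambda>x. (h x)\<^sup>2)" "integrable M (\<lambda>x. (L x)\<^sup>2)" "\<And>n. integrable M (\<lambda>x. (Y n x)\<^sup>2)"
    and lim: "(\<lambda>n. \<integral>x. (Y n x - L x)\<^sup>2 \<partial>M) \<longlonglongrightarrow> 0"
  shows "(\<lambda>n. \<integral>x. h x * Y n x \<partial>M) \<longlonglongrightarrow> (\<integral>x. h x * L x \<partial>M)"
proof (rule LIM_zero_cancel)
  have bound: "((\<integral>x. h x * Y n x \<partial>M) - (\<integral>x. h x * L x \<partial>M))\<^sup>2
      \<le> (\<integral>x. (h x)\<^sup>2 \<partial>M) * (\<integral>x. (Y n x - L x)\<^sup>2 \<partial>M)" for n
  proof -
    have "(\<integral>x. h x * Y n x \<partial>M) - (\<integral>x. h x * L x \<partial>M) = (\<integral>x. h x * (Y n x - L x) \<partial>M)"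
      using sq by (simp add: right_diff_distrib integrable_mult_of_square_integrable)
    then show ?thesis
      using Cauchy_Schwarz_integral[of h M "\<lambda>x. Y n x - L x"] sq by (simp add: square_integrable_diff)
  qed
  have "(\<lambda>n. ((\<integral>x. h x * Y n x \<partial>M) - (\<integral>x. h x * L x \<partial>M))\<^sup>2) \<longlonglongrightarrow> 0"
  proof (rule tendsto_sandwich[OF _ _ tendsto_const])
    show "(\<lambda>n. (\<integral>x. (h x)\<^sup>2 \<partial>M) * (\<integral>x. (Y n x - L x)\<^sup>2 \<partial>M)) \<longlonglongrightarrow> 0"
      using lim by (rule tendsto_mult_right_zero)
  qed (use bound in auto)
  then show "(\<lambda>n. (\<integral>x. h x * Y n x \<partial>M) - (\<integral>x. h x * L x \<partial>M)) \<longlonglongrightarrow> 0"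
    by simp
qed

lemma tendsto_integral_power2_of_L2:
  fixes L :: "'a \<Rightarrow> real" and Y :: "nat \<Rightarrow> 'a \<Rightarrow> real"
  assumes meas [measurable]: "L \<in> borel_measurable M" "\<And>n. Y n \<in> borel_measurable M"
    and sq: "integrable M (\<lambda>x. (L x)\<^sup>2)" "\<And>n. integrable M (\<lambda>x. (Y n x)\<^sup>2)"
    and lim: "(\<lambda>n. \<integral>x. (Y n x - L x)\<^sup>2 \<partial>M) \<longlonglongrightarrow> 0"
  shows "(\<lambda>n. \<integral>x. (Y n x)\<^sup>2 \<partial>M) \<longlonglongrightarrow> (\<integral>x. (L x)\<^sup>2 \<partial>M)"
proof -
  have "(\<integral>x. (Y n x)\<^sup>2 \<partial>M)
      = (\<integral>x. (Y n x - L x)\<^sup>2 \<partial>M) + 2 * (\<integral>x. L x * Y n x \<partial>M) - (\<integral>x. (L x)\<^sup>2 \<partial>M)" for n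
  proof -
    have "(\<integral>x. (Y n x)\<^sup>2 \<partial>M) = (\<integral>x. (Y n x - L x)\<^sup>2 + 2 * (L x * Y n x) - (L x)\<^sup>2 \<partial>M)"
      by (intro Bochner_Integration.integral_cong) (auto simp: power2_diff)
    then show ?thesis
      using sq by (simp add: square_integrable_diff integrable_mult_of_square_integrable)
  qed
  moreover have "(\<lambda>n. (\<integral>x. (Y n x - L x)\<^sup>2 \<partial>M) + 2 * (\<integral>x. L x * Y n x \<partial>M) - (\<integral>x. (L x)\<^sup>2 \<partial>M))
      \<longlonglongrightarrow> 0 + 2 * (\<integral>x. L x * L x \<partial>M) - (\<integral>x. (L x)\<^sup>2 \<partial>M)"
    by (intro tendsto_intros tendsto_integral_mult_of_L2 meas sq lim)
  ultimately show ?thesis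
    by (simp add: power2_eq_square)
qed

lemma tendsto_L2_diff:
  fixes f g :: "nat \<Rightarrow> 'a \<Rightarrow> real"
  assumes meas: "\<And>n. f n \<in> borel_measurable M" "\<And>n. g n \<in> borel_measurable M"
    and sq: "\<And>n. integrable M (\<lambda>x. (f n x)\<^sup>2)" "\<And>n. integrable M (\<lambda>x. (g n x)\<^sup>2)"
    and lim: "(\<lambda>n. \<integral>x. (f n x)\<^sup>2 \<partial>M) \<longlonglongrightarrow> 0" "(\<lambda>n. \<integral>x. (g n x)\<^sup>2 \<partial>M) \<longlonglongrightarrow> 0"
  shows "(\<lambda>n. \<integral>x. (f n x - g n x)\<^sup>2 \<partial>M) \<longlonglongrightarrow> 0"
proof (rule tendsto_sandwich[OF _ _ tendsto_const])
  have "(f n x - g n x)\<^sup>2 \<le> 2 * (f n x)\<^sup>2 + 2 * (g n x)\<^sup>2" for n x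
    using zero_le_power2[of "f n x + g n x"] unfolding power2_sum power2_diff by linarith
  then have "(\<integral>x. (f n x - g n x)\<^sup>2 \<partial>M) \<le> (\<integral>x. 2 * (f n x)\<^sup>2 + 2 * (g n x)\<^sup>2 \<partial>M)" for n
    using meas sq by (intro integral_mono square_integrable_diff) auto
  then show "\<forall>\<^sub>F n in sequentially. (\<integral>x. (f n x - g n x)\<^sup>2 \<partial>M)
      \<le> 2 * (\<integral>x. (f n x)\<^sup>2 \<partial>M) + 2 * (\<integral>x. (g n x)\<^sup>2 \<partial>M)"
    using sq by simp
  show "(\<lambda>n. 2 * (\<integral>x. (f n x)\<^sup>2 \<partial>M) + 2 * (\<integral>x. (g n x)\<^sup>2 \<partial>M)) \<longlonglongrightarrow> 0"
    using lim by (auto intro!: tendsto_eq_intros)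
qed simp

section \<open>Integrals of nonnegative limits and series\<close>

lemma integral_le_of_AE_tendsto:
  fixes X :: "nat \<Rightarrow> 'a \<Rightarrow> real"
  assumes int: "\<And>n. integrable M (X n)" and nonneg: "\<And>n x. 0 \<le> X n x"
    and bound: "\<And>n. (\<integral>x. X n x \<partial>M) \<le> B"
    and [measurable]: "Y \<in> borel_measurable M"
    and lim: "AE x in M. (\<lambda>n. X n x) \<longlonglongrightarrow> Y x"
  shows "integrable M Y" "(\<integral>x. Y x \<partial>M) \<le> B"
proof -
  have [measurable]: "X n \<in> borel_measurable M" for n
    using int by auto
  have "0 \<le> B"
    using nonneg by (intro order_trans[OF _ bound[of 0]] Bochner_Integration.integral_nonneg)
  have Y_nonneg: "AE x in M. 0 \<le> Y x"
    using lim by eventually_elim (use nonneg in \<open>auto intro: LIMSEQ_le_const\<close>)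
  have "AE x in M. ennreal (Y x) = liminf (\<lambda>n. ennreal (X n x))"
    using lim by eventually_elim (rule lim_imp_Liminf[symmetric], auto)
  then have "(\<integral>\<^sup>+x. ennreal (Y x) \<partial>M) = (\<integral>\<^sup>+x. liminf (\<lambda>n. ennreal (X n x)) \<partial>M)"
    by (rule nn_integral_cong_AE)
  also have "\<dots> \<le> liminf (\<lambda>n. \<integral>\<^sup>+x. ennreal (X n x) \<partial>M)"
    by (intro nn_integral_liminf) auto
  also have "\<dots> \<le> liminf (\<lambda>n. ennreal B)"
    using int nonneg bound
    by (intro Liminf_mono always_eventually allI) (simp add: nn_integral_eq_integral ennreal_leI)
  finally have nn_integral_le: "(\<integral>\<^sup>+x. ennreal (Y x) \<partial>M) \<le> ennreal B"
    by (simp add: Liminf_const)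
  then show integrable_Y: "integrable M Y"
    using Y_nonneg by (intro integrableI_nonneg) (auto simp: less_top[symmetric] top_unique)
  show "(\<integral>x. Y x \<partial>M) \<le> B"
    using nn_integral_le \<open>0 \<le> B\<close> by (simp add: nn_integral_eq_integral[OF integrable_Y Y_nonneg])
qed

lemma AE_summable_of_summable_integral:
  fixes f :: "nat \<Rightarrow> 'a \<Rightarrow> real"
  assumes int: "\<And>i. integrable M (f i)" and nonneg: "\<And>i x. 0 \<le> f i x"
    and summ: "summable (\<lambda>i. \<integral>x. f i x \<partial>M)"
  shows "AE x in M. summable (\<lambda>i. f i x)"
proof -
  have [measurable]: "f i \<in> borel_measurable M" for i
    using int by auto
  have "(\<integral>\<^sup>+x. (\<Sum>i. ennreal (f i x)) \<partial>M) = (\<Sum>i. \<integral>\<^sup>+x. ennreal (f i x) \<partial>M)"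
    by (intro nn_integral_suminf) auto
  also have "\<dots> = ennreal (\<Sum>i. \<integral>x. f i x \<partial>M)"
    using int nonneg summ by (simp add: nn_integral_eq_integral suminf_ennreal2)
  finally have "AE x in M. (\<Sum>i. ennreal (f i x)) \<noteq> \<infinity>"
    by (intro nn_integral_noteq_infinite) auto
  then show ?thesis
    by eventually_elim (use nonneg in \<open>auto intro!: summable_suminf_not_top\<close>)
qed

lemma sums_set_integral_nonneg:
  fixes f :: "nat \<Rightarrow> 'a \<Rightarrow> real"
  assumes int: "\<And>k. set_integrable M A (f k)" and nonneg: "\<And>k x. x \<in> A \<Longrightarrow> 0 \<le> f k x"
    and sums: "\<And>x. x \<in> A \<Longrightarrow> (\<lambda>k. f k x) sums s x"
    and summ: "summable (\<lambda>k. LINT x:A|M. f k x)"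
  shows "(\<lambda>k. LINT x:A|M. f k x) sums (LINT x:A|M. s x)"
proof -
  define h where "h k x = indicator A x *\<^sub>R f k x" for k x
  have h_nonneg: "0 \<le> h k x" for k x
    using nonneg by (auto simp: h_def indicator_def)
  have h_sums: "(\<lambda>k. h k x) sums (indicator A x *\<^sub>R s x)" for x
    using sums by (cases "x \<in> A") (auto simp: h_def)
  have "(\<lambda>k. \<integral>x. h k x \<partial>M) sums (\<integral>x. (\<Sum>k. h k x) \<partial>M)"
  proof (rule sums_integral)
    show "integrable M (h k)" for k
      using int by (simp add: set_integrable_def h_def[abs_def])
    show "AE x in M. summable (\<lambda>k. norm (h k x))"
      using h_nonneg sums_summable[OF h_sums] by simp
    show "summable (\<lambda>k. \<integral>x. norm (h k x) \<partial>M)"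
      using h_nonneg summ by (simp add: set_lebesgue_integral_def h_def)
  qed
  then show ?thesis
    by (simp only: set_lebesgue_integral_def h_def[symmetric] sums_unique[OF h_sums])
qed

section \<open>Square-integrable martingale differences\<close>

locale filtered_finite_measure = finite_measure M + filtration "space M" F
  for M :: "'a measure" and F :: "nat \<Rightarrow> 'a measure" +
  assumes sets_F_subset: "sets (F n) \<subseteq> sets M"
begin

sublocale F: finite_measure_subalgebra M "F n" for n
  by unfold_locales (simp add: subalgebra_def space_F sets_F_subset)

lemma borel_measurable_of_F: "f \<in> borel_measurable (F n) \<Longrightarrow> f \<in> borel_measurable M"
  by (rule measurable_from_subalg[OF F.subalg])

lemma borel_measurable_F_mono:
  "m \<le> n \<Longrightarrow> f \<in> borel_measurable (F m) \<Longrightarrow> f \<in> borel_measurable (F n)"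
  using sets_F_mono by (auto intro!: measurable_from_subalg[of "F n" "F m"] simp: subalgebra_def space_F)

end

locale martingale_differences = filtered_finite_measure +
  fixes X :: "nat \<Rightarrow> 'a \<Rightarrow> real"
  assumes adapted: "X n \<in> borel_measurable (F (Suc n))"
    and square_integrable: "integrable M (\<lambda>\<omega>. (X n \<omega>)\<^sup>2)"
    and cond_exp_eq_0: "AE \<omega> in M. real_cond_exp M (F n) (X n) \<omega> = 0"
begin

lemma borel_measurable [measurable]: "X n \<in> borel_measurable M"
  using adapted by (rule borel_measurable_of_F)

lemma integrable: "integrable M (X n)"
  using square_integrable by (rule square_integrable_imp_integrable[OF borel_measurable])

lemma partial_sum_adapted: "(\<lambda>\<omega>. \<Sum>k<n. X k \<omega>) \<in> borel_measurable (F n)"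
  by (intro borel_measurable_sum borel_measurable_F_mono[OF _ adapted]) auto

lemma integral_mult_eq_0:
  assumes Y: "Y \<in> borel_measurable (F n)" and int: "integrable M (\<lambda>\<omega>. Y \<omega> * X n \<omega>)"
  shows "(\<integral>\<omega>. Y \<omega> * X n \<omega> \<partial>M) = 0"
proof -
  have "(\<integral>\<omega>. Y \<omega> * X n \<omega> \<partial>M) = (\<integral>\<omega>. Y \<omega> * real_cond_exp M (F n) (X n) \<omega> \<partial>M)"
    using F.real_cond_exp_intg(2)[OF int Y] by simp
  also have "\<dots> = 0"
    using cond_exp_eq_0[of n] by (intro integral_eq_zero_AE) auto
  finally show ?thesis .
qed

lemma integral_eq_0: "(\<integral>\<omega>. X n \<omega> \<partial>M) = 0"
  using integral_mult_eq_0[of "\<lambda>_. 1"] integrable by simp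

lemma set_integral_eq_0:
  assumes "A \<in> sets (F n)"
  shows "(LINT \<omega>:A|M. X n \<omega>) = 0"
proof -
  have "integrable M (\<lambda>\<omega>. indicator A \<omega> * X n \<omega>)"
    using integrable_mult_indicator[OF _ integrable, of A] assms sets_F_subset by auto
  then show ?thesis
    using integral_mult_eq_0[of "indicator A"] assms by (simp add: set_lebesgue_integral_def)
qed

lemma martingale_partial_sums: "is_martingale M F (\<lambda>n \<omega>. \<Sum>k<n. X k \<omega>)"
  unfolding is_martingale_def
proof (intro allI conjI ballI)
  fix n A assume A: "A \<in> sets (F n)"
  then have AM: "A \<in> sets M"
    using sets_F_subset by blast
  have "set_integrable M A (X n)" "set_integrable M A (\<lambda>\<omega>. \<Sum>k<n. X k \<omega>)"
    unfolding set_integrable_def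
    by (intro integrable_mult_indicator AM Bochner_Integration.integrable_sum integrable)+
  then show "(LINT \<omega>:A|M. (\<Sum>k<Suc n. X k \<omega>)) = (LINT \<omega>:A|M. (\<Sum>k<n. X k \<omega>))"
    using set_integral_eq_0[OF A] by (simp add: set_integral_add(2))
qed (intro Bochner_Integration.integrable_sum integrable partial_sum_adapted)+

lemma martingale_differences_scale: "martingale_differences M F (\<lambda>n \<omega>. a n * X n \<omega>)"
proof unfold_locales
  show "AE \<omega> in M. real_cond_exp M (F n) (\<lambda>\<omega>. a n * X n \<omega>) \<omega> = 0" for n
    using F.real_cond_exp_cmult[OF integrable, of n "a n" n] cond_exp_eq_0[of n] by eventually_elim simp
qed (auto simp: power_mult_distrib square_integrable intro!: borel_measurable_times adapted)

lemma martingale_differences_shift: "martingale_differences M (\<lambda>n. F (n + m)) (\<lambda>n. X (n + m))"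
  using adapted[of "_ + m"] square_integrable cond_exp_eq_0 space_F sets_F_mono sets_F_subset
  by unfold_locales auto

lemma second_moment_add_mult:
  assumes Y: "Y \<in> borel_measurable (F n)" and b: "b \<in> borel_measurable (F n)"
    and Y2: "integrable M (\<lambda>\<omega>. (Y \<omega>)\<^sup>2)" and b_le: "\<And>\<omega>. \<bar>b \<omega>\<bar> \<le> 1"
  shows "integrable M (\<lambda>\<omega>. (b \<omega> * X n \<omega>)\<^sup>2)"
    and "integrable M (\<lambda>\<omega>. (Y \<omega> + b \<omega> * X n \<omega>)\<^sup>2)"
    and "(\<integral>\<omega>. (Y \<omega> + b \<omega> * X n \<omega>)\<^sup>2 \<partial>M) = (\<integral>\<omega>. (Y \<omega>)\<^sup>2 \<partial>M) + (\<integral>\<omega>. (b \<omega> * X n \<omega>)\<^sup>2 \<partial>M)"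
proof -
  have [measurable]: "Y \<in> borel_measurable M" "b \<in> borel_measurable M"
    using Y b by (auto intro: borel_measurable_of_F)
  have "(b \<omega> * X n \<omega>)\<^sup>2 \<le> (X n \<omega>)\<^sup>2" for \<omega>
    using mult_right_mono[of "(b \<omega>)\<^sup>2" 1 "(X n \<omega>)\<^sup>2"] b_le[of \<omega>]
    by (simp add: power_mult_distrib abs_square_le_1)
  then show bX: "integrable M (\<lambda>\<omega>. (b \<omega> * X n \<omega>)\<^sup>2)"
    by (intro Bochner_Integration.integrable_bound[OF square_integrable[of n]]) auto
  have YbX: "integrable M (\<lambda>\<omega>. Y \<omega> * b \<omega> * X n \<omega>)"
    using integrable_mult_of_square_integrable[OF _ _ Y2 bX] by (simp add: mult.assoc)
  have "(\<integral>\<omega>. Y \<omega> * b \<omega> * X n \<omega> \<partial>M) = 0"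
    using Y b YbX by (intro integral_mult_eq_0) auto
  then show "(\<integral>\<omega>. (Y \<omega> + b \<omega> * X n \<omega>)\<^sup>2 \<partial>M) = (\<integral>\<omega>. (Y \<omega>)\<^sup>2 \<partial>M) + (\<integral>\<omega>. (b \<omega> * X n \<omega>)\<^sup>2 \<partial>M)"
    using Y2 bX YbX by (simp add: power2_sum mult.assoc)
  show "integrable M (\<lambda>\<omega>. (Y \<omega> + b \<omega> * X n \<omega>)\<^sup>2)"
    by (intro square_integrable_add Y2 bX) auto
qed

lemma partial_sum_second_moment:
  "integrable M (\<lambda>\<omega>. (\<Sum>k<n. X k \<omega>)\<^sup>2)"
  "(\<integral>\<omega>. (\<Sum>k<n. X k \<omega>)\<^sup>2 \<partial>M) = (\<Sum>k<n. \<integral>\<omega>. (X k \<omega>)\<^sup>2 \<partial>M)"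
proof (induction n)
  case (Suc n)
  case 1
  show ?case
    using second_moment_add_mult(2)[OF partial_sum_adapted, of "\<lambda>_. 1"] Suc by simp
  case 2
  show ?case
    using second_moment_add_mult(3)[OF partial_sum_adapted, of "\<lambda>_. 1"] Suc by simp
qed simp_all

text \<open>Freezing the partial sums once they leave \<open>(-e, e)\<close> keeps their increments orthogonal.\<close>

primrec stopped_sum :: "real \<Rightarrow> nat \<Rightarrow> 'a \<Rightarrow> real" where
  "stopped_sum e 0 \<omega> = 0"
| "stopped_sum e (Suc n) \<omega> = stopped_sum e n \<omega> + of_bool (\<bar>stopped_sum e n \<omega>\<bar> < e) * X n \<omega>"

lemma stopped_sum_adapted: "stopped_sum e n \<in> borel_measurable (F n)"
proof (induction n)
  case (Suc n)
  from borel_measurable_F_mono[OF _ Suc, of "Suc n"]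
  have [measurable]: "stopped_sum e n \<in> borel_measurable (F (Suc n))"
    by simp
  have [measurable]: "X n \<in> borel_measurable (F (Suc n))"
    by (rule adapted)
  show ?case
    unfolding stopped_sum.simps(2)[abs_def] by measurable
qed simp

lemma stopped_sum_second_moment:
  "integrable M (\<lambda>\<omega>. (stopped_sum e n \<omega>)\<^sup>2)"
  "(\<integral>\<omega>. (stopped_sum e n \<omega>)\<^sup>2 \<partial>M) \<le> (\<Sum>k<n. \<integral>\<omega>. (X k \<omega>)\<^sup>2 \<partial>M)"
proof (induction n)
  case (Suc n)
  define b :: "'a \<Rightarrow> real" where "b \<omega> = of_bool (\<bar>stopped_sum e n \<omega>\<bar> < e)" for \<omega>
  have [measurable]: "stopped_sum e n \<in> borel_measurable (F n)"
    by (rule stopped_sum_adapted)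
  have b: "b \<in> borel_measurable (F n)"
    unfolding b_def[abs_def] by measurable
  note moments = second_moment_add_mult[OF stopped_sum_adapted b Suc(1)]
  case 1
  show ?case
    using moments(2) by (simp add: b_def)
  case 2
  have "(\<integral>\<omega>. (b \<omega> * X n \<omega>)\<^sup>2 \<partial>M) \<le> (\<integral>\<omega>. (X n \<omega>)\<^sup>2 \<partial>M)"
    using moments(1) by (intro integral_mono square_integrable) (auto simp: b_def)
  then show ?case
    using moments(3) Suc(2) by (simp add: b_def)
qed simp_all

lemma stopped_sum_ge:
  assumes "e \<le> \<bar>\<Sum>i<k. X i \<omega>\<bar>" "k \<le> n"
  shows "e \<le> \<bar>stopped_sum e n \<omega>\<bar>"
proof -
  have "(\<forall>k\<le>n. \<bar>\<Sum>i<k. X i \<omega>\<bar> < e) \<and> stopped_sum e n \<omega> = (\<Sum>i<n. X i \<omega>) \<or> e \<le> \<bar>stopped_sum e n \<omega>\<bar>"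
    by (induction n) (auto simp: le_Suc_eq)
  then show ?thesis
    using assms by force
qed

theorem maximal_inequality:
  assumes "0 < e"
  shows "measure M {\<omega> \<in> space M. \<exists>k\<le>n. e \<le> \<bar>\<Sum>i<k. X i \<omega>\<bar>} \<le> (\<Sum>k<n. \<integral>\<omega>. (X k \<omega>)\<^sup>2 \<partial>M) / e\<^sup>2"
proof -
  have [measurable]: "stopped_sum e n \<in> borel_measurable M"
    using stopped_sum_adapted by (rule borel_measurable_of_F)
  have "measure M {\<omega> \<in> space M. \<exists>k\<le>n. e \<le> \<bar>\<Sum>i<k. X i \<omega>\<bar>} \<le> measure M {\<omega> \<in> space M. e \<le> \<bar>stopped_sum e n \<omega>\<bar>}"
    by (intro finite_measure_mono) (auto intro: stopped_sum_ge)
  also have "\<dots> \<le> (\<integral>\<omega>. (stopped_sum e n \<omega>)\<^sup>2 \<partial>M) / e\<^sup>2"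
    using assms by (intro second_moment_method stopped_sum_second_moment) auto
  also have "\<dots> \<le> (\<Sum>k<n. \<integral>\<omega>. (X k \<omega>)\<^sup>2 \<partial>M) / e\<^sup>2"
    by (intro divide_right_mono stopped_sum_second_moment) auto
  finally show ?thesis .
qed

lemma maximal_inequality_infinite:
  assumes "0 < e" and summ: "summable (\<lambda>k. \<integral>\<omega>. (X k \<omega>)\<^sup>2 \<partial>M)"
  shows "measure M {\<omega> \<in> space M. \<exists>k. e \<le> \<bar>\<Sum>i<k. X i \<omega>\<bar>} \<le> (\<Sum>k. \<integral>\<omega>. (X k \<omega>)\<^sup>2 \<partial>M) / e\<^sup>2"
proof -
  define A where "A n = {\<omega> \<in> space M. \<exists>k\<le>n. e \<le> \<bar>\<Sum>i<k. X i \<omega>\<bar>}" for n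
  have "measure M (A n) \<le> (\<Sum>k. \<integral>\<omega>. (X k \<omega>)\<^sup>2 \<partial>M) / e\<^sup>2" for n
  proof -
    have "measure M (A n) \<le> (\<Sum>k<n. \<integral>\<omega>. (X k \<omega>)\<^sup>2 \<partial>M) / e\<^sup>2"
      unfolding A_def using assms(1) by (rule maximal_inequality)
    also have "\<dots> \<le> (\<Sum>k. \<integral>\<omega>. (X k \<omega>)\<^sup>2 \<partial>M) / e\<^sup>2"
      by (intro divide_right_mono sum_le_suminf summ) auto
    finally show ?thesis .
  qed
  moreover have "(\<lambda>n. measure M (A n)) \<longlonglongrightarrow> measure M (\<Union>n. A n)"
    by (rule finite_Lim_measure_incseq) (auto simp: A_def incseq_def intro: le_trans)
  ultimately have "measure M (\<Union>n. A n) \<le> (\<Sum>k. \<integral>\<omega>. (X k \<omega>)\<^sup>2 \<partial>M) / e\<^sup>2"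
    by (intro LIMSEQ_le_const2) auto
  also have "(\<Union>n. A n) = {\<omega> \<in> space M. \<exists>k. e \<le> \<bar>\<Sum>i<k. X i \<omega>\<bar>}"
    by (auto simp: A_def)
  finally show ?thesis .
qed

lemma measure_oscillation_eq_0:
  assumes "0 < e" and summ: "summable (\<lambda>k. \<integral>\<omega>. (X k \<omega>)\<^sup>2 \<partial>M)"
  shows "measure M {\<omega> \<in> space M. \<forall>m. \<exists>k. e \<le> \<bar>\<Sum>i<k. X (i + m) \<omega>\<bar>} = 0" (is "measure M ?N = 0")
proof -
  have "measure M ?N \<le> (\<Sum>k. \<integral>\<omega>. (X (k + m) \<omega>)\<^sup>2 \<partial>M) / e\<^sup>2" for m
  proof -
    interpret shift: martingale_differences M "\<lambda>n. F (n + m)" "\<lambda>n. X (n + m)"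
      by (rule martingale_differences_shift)
    have "measure M ?N \<le> measure M {\<omega> \<in> space M. \<exists>k. e \<le> \<bar>\<Sum>i<k. X (i + m) \<omega>\<bar>}"
      by (intro finite_measure_mono) auto
    also have "\<dots> \<le> (\<Sum>k. \<integral>\<omega>. (X (k + m) \<omega>)\<^sup>2 \<partial>M) / e\<^sup>2"
      using summable_ignore_initial_segment[OF summ] assms(1) by (intro shift.maximal_inequality_infinite)
    finally show ?thesis .
  qed
  moreover have "(\<lambda>m. (\<Sum>k. \<integral>\<omega>. (X (k + m) \<omega>)\<^sup>2 \<partial>M) / e\<^sup>2) \<longlonglongrightarrow> 0"
    using tendsto_divide[OF suminf_tail_tendsto_0[OF summ] tendsto_const, of "e\<^sup>2"] assms(1) by simp
  ultimately have "measure M ?N \<le> 0"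
    by (intro LIMSEQ_le_const) auto
  then show ?thesis
    by (simp add: measure_le_0_iff)
qed

theorem AE_summable:
  assumes summ: "summable (\<lambda>k. \<integral>\<omega>. (X k \<omega>)\<^sup>2 \<partial>M)"
  shows "AE \<omega> in M. summable (\<lambda>k. X k \<omega>)"
proof -
  have "AE \<omega> in M. \<forall>j. \<exists>m. \<forall>k. \<bar>\<Sum>i<k. X (i + m) \<omega>\<bar> < inverse (real (Suc j))"
    unfolding AE_all_countable
  proof
    fix j
    define N where "N = {\<omega> \<in> space M. \<forall>m. \<exists>k. inverse (real (Suc j)) \<le> \<bar>\<Sum>i<k. X (i + m) \<omega>\<bar>}"
    have "measure M N = 0"
      unfolding N_def by (intro measure_oscillation_eq_0 summ) simp
    moreover have "N \<in> sets M"
      unfolding N_def by measurable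
    ultimately have "AE \<omega> in M. \<omega> \<notin> N"
      by (intro AE_not_in) (simp add: null_sets_def emeasure_eq_measure)
    then show "AE \<omega> in M. \<exists>m. \<forall>k. \<bar>\<Sum>i<k. X (i + m) \<omega>\<bar> < inverse (real (Suc j))"
      using AE_space by eventually_elim (auto simp: N_def not_le)
  qed
  then show ?thesis
    by eventually_elim (simp add: summable_of_small_block_sums)
qed

lemma suminf_second_moment_le:
  assumes summ: "summable (\<lambda>k. \<integral>\<omega>. (X k \<omega>)\<^sup>2 \<partial>M)"
  shows "integrable M (\<lambda>\<omega>. (\<Sum>k. X k \<omega>)\<^sup>2)"
    and "(\<integral>\<omega>. (\<Sum>k. X k \<omega>)\<^sup>2 \<partial>M) \<le> (\<Sum>k. \<integral>\<omega>. (X k \<omega>)\<^sup>2 \<partial>M)"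
proof -
  have bound: "(\<integral>\<omega>. (\<Sum>k<n. X k \<omega>)\<^sup>2 \<partial>M) \<le> (\<Sum>k. \<integral>\<omega>. (X k \<omega>)\<^sup>2 \<partial>M)" for n
    unfolding partial_sum_second_moment by (intro sum_le_suminf summ) auto
  have lim: "AE \<omega> in M. (\<lambda>n. (\<Sum>k<n. X k \<omega>)\<^sup>2) \<longlonglongrightarrow> (\<Sum>k. X k \<omega>)\<^sup>2"
    using AE_summable[OF summ] by eventually_elim (intro tendsto_power summable_LIMSEQ)
  show "integrable M (\<lambda>\<omega>. (\<Sum>k. X k \<omega>)\<^sup>2)"
    and "(\<integral>\<omega>. (\<Sum>k. X k \<omega>)\<^sup>2 \<partial>M) \<le> (\<Sum>k. \<integral>\<omega>. (X k \<omega>)\<^sup>2 \<partial>M)"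
    using integral_le_of_AE_tendsto[OF partial_sum_second_moment(1) _ bound _ lim] by auto
qed

theorem L2_tendsto_suminf:
  assumes summ: "summable (\<lambda>k. \<integral>\<omega>. (X k \<omega>)\<^sup>2 \<partial>M)"
  shows "(\<lambda>n. \<integral>\<omega>. ((\<Sum>k<n. X k \<omega>) - (\<Sum>k. X k \<omega>))\<^sup>2 \<partial>M) \<longlonglongrightarrow> 0"
proof (rule tendsto_sandwich)
  have "(\<integral>\<omega>. ((\<Sum>k<n. X k \<omega>) - (\<Sum>k. X k \<omega>))\<^sup>2 \<partial>M) \<le> (\<Sum>k. \<integral>\<omega>. (X (k + n) \<omega>)\<^sup>2 \<partial>M)" for n
  proof -
    interpret shift: martingale_differences M "\<lambda>k. F (k + n)" "\<lambda>k. X (k + n)"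
      by (rule martingale_differences_shift)
    have "AE \<omega> in M. ((\<Sum>k<n. X k \<omega>) - (\<Sum>k. X k \<omega>))\<^sup>2 = (\<Sum>k. X (k + n) \<omega>)\<^sup>2"
      using AE_summable[OF summ]
    proof eventually_elim
      case (elim \<omega>)
      show ?case
        unfolding suminf_minus_initial_segment[OF elim] by (rule power2_commute)
    qed
    then have "(\<integral>\<omega>. ((\<Sum>k<n. X k \<omega>) - (\<Sum>k. X k \<omega>))\<^sup>2 \<partial>M) = (\<integral>\<omega>. (\<Sum>k. X (k + n) \<omega>)\<^sup>2 \<partial>M)"
      by (intro integral_cong_AE) auto
    also have "\<dots> \<le> (\<Sum>k. \<integral>\<omega>. (X (k + n) \<omega>)\<^sup>2 \<partial>M)"
      by (intro shift.suminf_second_moment_le summable_ignore_initial_segment summ)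
    finally show ?thesis .
  qed
  then show "\<forall>\<^sub>F n in sequentially. (\<integral>\<omega>. ((\<Sum>k<n. X k \<omega>) - (\<Sum>k. X k \<omega>))\<^sup>2 \<partial>M) \<le> (\<Sum>k. \<integral>\<omega>. (X (k + n) \<omega>)\<^sup>2 \<partial>M)"
    by simp
qed (auto intro: suminf_tail_tendsto_0 summ)

corollary integral_suminf_eq_0:
  assumes summ: "summable (\<lambda>k. \<integral>\<omega>. (X k \<omega>)\<^sup>2 \<partial>M)"
  shows "(\<integral>\<omega>. (\<Sum>k. X k \<omega>) \<partial>M) = 0"
proof -
  have "(\<lambda>n. \<integral>\<omega>. 1 * (\<Sum>k<n. X k \<omega>) \<partial>M) \<longlonglongrightarrow> (\<integral>\<omega>. 1 * (\<Sum>k. X k \<omega>) \<partial>M)"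
    by (intro tendsto_integral_mult_of_L2 L2_tendsto_suminf suminf_second_moment_le
        partial_sum_second_moment summ) auto
  then have "(\<lambda>n::nat. 0) \<longlonglongrightarrow> (\<integral>\<omega>. (\<Sum>k. X k \<omega>) \<partial>M)"
    by (simp add: integrable integral_eq_0)
  then show ?thesis
    by (rule LIMSEQ_unique) simp
qed

corollary second_moment_suminf_sums:
  assumes summ: "summable (\<lambda>k. \<integral>\<omega>. (X k \<omega>)\<^sup>2 \<partial>M)"
  shows "(\<lambda>k. \<integral>\<omega>. (X k \<omega>)\<^sup>2 \<partial>M) sums (\<integral>\<omega>. (\<Sum>k. X k \<omega>)\<^sup>2 \<partial>M)"
  unfolding sums_def partial_sum_second_moment(2)[symmetric]
  by (intro tendsto_integral_power2_of_L2 L2_tendsto_suminf suminf_second_moment_le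
      partial_sum_second_moment summ) auto

end

section \<open>A linear recurrence and its generating function\<close>

lemma affine_recurrence_pochhammer:
  fixes w :: "nat \<Rightarrow> 'a::field_char_0"
  assumes "w 0 = 0" and rec: "\<And>n. of_nat (Suc n) * w (Suc n) = 1 + (of_nat n + a) * w n"
    and "a \<noteq> 1"
  shows "w n = (pochhammer a n / fact n - 1) / (a - 1)"
proof (induction n)
  case (Suc n)
  define P where "P = pochhammer a n / fact n"
  have P_Suc: "pochhammer a (Suc n) / fact (Suc n) = (of_nat n + a) * P / of_nat (Suc n)"
    by (simp add: P_def pochhammer_Suc field_simps del: of_nat_Suc)
  have "w (Suc n) = (1 + (of_nat n + a) * w n) / of_nat (Suc n)"
    by (simp add: rec[symmetric] del: of_nat_Suc)
  also have "1 + (of_nat n + a) * w n = ((of_nat n + a) * P - of_nat (Suc n)) / (a - 1)"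
    using \<open>a \<noteq> 1\<close> unfolding Suc.IH P_def[symmetric] by (simp add: field_simps)
  also have "\<dots> / of_nat (Suc n) = ((of_nat n + a) * P / of_nat (Suc n) - 1) / (a - 1)"
    by (simp add: diff_divide_distrib del: of_nat_Suc)
  finally show ?case
    by (simp only: P_Suc)
qed (simp add: \<open>w 0 = 0\<close>)

lemma affine_recurrence_harm:
  fixes w :: "nat \<Rightarrow> 'a::real_normed_field"
  assumes "w 0 = 0" and rec: "\<And>n. of_nat (Suc n) * w (Suc n) = 1 + (of_nat n + 1) * w n"
  shows "w n = harm n"
proof (induction n)
  case (Suc n)
  have "of_nat (Suc n) * w (Suc n) = of_nat (Suc n) * (harm n + inverse (of_nat (Suc n)))"
    using rec[of n] Suc.IH by (simp add: distrib_left add.commute del: of_nat_Suc) (simp add: distrib_left)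
  then show ?case
    by (simp add: harm_Suc del: of_nat_Suc)
qed (simp add: \<open>w 0 = 0\<close> harm_def)

lemma pochhammer_series:
  fixes a x :: real
  assumes "\<bar>x\<bar> < 1"
  shows "(\<lambda>n. pochhammer a n / fact n * x ^ n) sums (1 - x) powr (- a)"
proof -
  have "(\<lambda>n. (- a gchoose n) * (- x) ^ n) sums (1 + - x) powr (- a)"
    using assms by (intro gen_binomial_real) simp
  moreover have "(- a gchoose n) * (- x) ^ n = pochhammer a n / fact n * x ^ n" for n
  proof -
    have "(- 1 :: real) ^ n * (- x) ^ n = x ^ n"
      by (simp flip: power_mult_distrib)
    then show ?thesis by (simp add: gbinomial_pochhammer)
  qed
  ultimately show ?thesis by simp
qed

lemma convolution_harmonic_geometric:
  fixes x :: "'a::real_normed_field"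
  shows "(\<Sum>i\<le>n. x ^ i / of_nat i * x ^ (n - i)) = harm n * x ^ n"
proof -
  have "(\<Sum>i\<le>n. x ^ i / of_nat i * x ^ (n - i)) = (\<Sum>i\<le>n. inverse (of_nat i) * x ^ n)"
  proof (intro sum.cong refl)
    fix i assume "i \<in> {..n}"
    then have "x ^ n = x ^ i * x ^ (n - i)"
      by (simp flip: power_add)
    then show "x ^ i / of_nat i * x ^ (n - i) = inverse (of_nat i) * x ^ n"
      by (simp add: divide_inverse mult_ac)
  qed
  also have "\<dots> = (\<Sum>i=1..n. inverse (of_nat i)) * x ^ n"
    unfolding sum_distrib_right by (intro sum.mono_neutral_right) auto
  finally show ?thesis
    by (simp add: harm_def)
qed

lemma harm_series:
  fixes x :: real
  assumes "\<bar>x\<bar> < 1"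
  shows "(\<lambda>n. harm n * x ^ n) sums (- ln (1 - x) / (1 - x))"
proof -
  have ln: "(\<lambda>n. x ^ n / real n) sums (- ln (1 - x))"
    using sums_minus[OF ln_series'[of "- x"]] assms by simp
  have "summable (\<lambda>n. norm (x ^ n / real n))"
  proof (rule summable_comparison_test'[of _ 0])
    show "summable (\<lambda>n. \<bar>x\<bar> ^ n)"
      using assms by (intro summable_geometric) simp
    show "norm (norm (x ^ n / real n)) \<le> \<bar>x\<bar> ^ n" for n
      using divide_left_mono[of 1 "real n" "\<bar>x\<bar> ^ n"] by (cases "n = 0") (auto simp: power_abs)
  qed
  moreover have "summable (\<lambda>n. norm (x ^ n))"
    using assms by (simp add: power_abs summable_geometric)
  ultimately have "(\<lambda>n. \<Sum>i\<le>n. x ^ i / real i * x ^ (n - i)) sums ((\<Sum>n. x ^ n / real n) * (\<Sum>n. x ^ n))"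
    by (rule Cauchy_product_sums)
  moreover have "(\<Sum>n. x ^ n / real n) * (\<Sum>n. x ^ n) = - ln (1 - x) / (1 - x)"
    using sums_unique[OF ln] suminf_geometric[of x] assms by simp
  ultimately show ?thesis
    by (simp only: convolution_harmonic_geometric)
qed

section \<open>The weights of the alternating sum\<close>

text \<open>
  For \<open>k \<ge> 1\<close> Euler's integral makes this \<open>\<^sub>2F\<^sub>1(1 - q, 1; k + 1; 1/2) / 2\<close>, which is
  \<open>\<^sub>2F\<^sub>1(1, k + q; k + 1; - 1)\<close> by Pfaff's transformation.
\<close>

definition hyp_weight :: "real \<Rightarrow> nat \<Rightarrow> real" where
  "hyp_weight q k = (LINT u:{0..1}|lborel. real k * (1 - u) ^ (k - 1) * (1 - u / 2) powr (q - 1)) / 2"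

lemma hyp_weight_nonneg: "0 \<le> hyp_weight q k"
  unfolding hyp_weight_def set_lebesgue_integral_def
  by (intro divide_nonneg_pos Bochner_Integration.integral_nonneg) (auto simp: indicator_def)

lemma hyp_weight_recurrence:
  assumes "k \<ge> 1"
  shows "hyp_weight q k = 1 - (real k + q) / (real k + 1) * hyp_weight q (Suc k)"
proof -
  define \<rho> where "\<rho> u = (1 - u / 2) powr (q - 1)" for u :: real
  define G' where "G' u = - (1 / 2) * (real k * (1 - u) ^ (k - 1) * \<rho> u + (real k + q) * ((1 - u) ^ k * \<rho> u))"
    for u
  have "(\<integral>u. G' u * indicator {0..1} u \<partial>lborel)
      = (1 - 1) ^ k * (1 - 1 / 2) powr q - (1 - 0) ^ k * (1 - 0 / 2) powr q"
  proof (rule integral_FTC_Icc_real)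
    fix u :: real assume u: "0 \<le> u" "u \<le> 1"
    have powr_q: "(1 - u / 2) powr q = (1 - u / 2) * \<rho> u"
      and power_k: "(1 - u) ^ k = (1 - u) * (1 - u) ^ (k - 1)"
      using u assms powr_mult_base[of "1 - u / 2" "q - 1"] by (simp_all add: \<rho>_def power_eq_if)
    have "((\<lambda>u. (1 - u) ^ k * (1 - u / 2) powr q) has_real_derivative
        - (real k * (1 - u) ^ (k - 1)) * (1 - u / 2) powr q + (1 - u) ^ k * (- (q * \<rho> u / 2))) (at u)"
      unfolding \<rho>_def using u by (auto intro!: derivative_eq_intros simp: field_simps)
    then show "((\<lambda>u. (1 - u) ^ k * (1 - u / 2) powr q) has_real_derivative G' u) (at u)"
      by (rule DERIV_cong) (simp only: G'_def powr_q power_k, simp add: algebra_simps add_divide_distrib)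
    show "isCont G' u"
      unfolding G'_def \<rho>_def using u by (intro continuous_intros) auto
  qed simp
  then have "(LINT u:{0..1}|lborel. G' u) = - 1"
    using assms by (simp add: set_lebesgue_integral_def mult.commute power_0_left)
  moreover have "(LINT u:{0..1}|lborel. G' u)
      = - (1 / 2) * (2 * hyp_weight q k + (real k + q) * (LINT u:{0..1}|lborel. (1 - u) ^ k * \<rho> u))"
  proof -
    have "set_integrable lborel {0..1} (\<lambda>u. real k * (1 - u) ^ (k - 1) * \<rho> u)"
      and "set_integrable lborel {0..1} (\<lambda>u. (real k + q) * ((1 - u) ^ k * \<rho> u))"
      unfolding \<rho>_def by (intro borel_integrable_atLeastAtMost' continuous_intros; force)+
    then show ?thesis
      by (simp only: G'_def set_integral_mult_right set_integral_add) (simp add: hyp_weight_def \<rho>_def)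
  qed
  moreover have "2 * hyp_weight q (Suc k) = (real k + 1) * (LINT u:{0..1}|lborel. (1 - u) ^ k * \<rho> u)"
    by (simp add: hyp_weight_def \<rho>_def mult.assoc add.commute)
  ultimately have "2 * ((real k + 1) * hyp_weight q k) + 2 * ((real k + q) * hyp_weight q (Suc k))
      = 2 * (real k + 1)"
    by algebra
  then show ?thesis
    by (simp add: field_simps)
qed

lemma hyp_weight_le_1:
  assumes "- 1 \<le> q"
  shows "hyp_weight q k \<le> 1"
proof (cases "k = 0")
  case False
  then have "0 \<le> (real k + q) / (real k + 1) * hyp_weight q (Suc k)"
    using assms by (intro mult_nonneg_nonneg hyp_weight_nonneg) auto
  then show ?thesis
    using hyp_weight_recurrence[of k q] False by simp
qed (simp add: hyp_weight_def set_lebesgue_integral_def)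

lemma integral_power_unit_interval:
  assumes "k \<ge> 1"
  shows "(LINT u:{0..1}|lborel. real k * (1 - u) ^ (k - 1)) = 1"
proof -
  have "(\<integral>u. real k * (1 - u) ^ (k - 1) * indicator {0..1} u \<partial>lborel) = - ((1 - 1) ^ k) - - ((1 - 0) ^ k)"
    by (rule integral_FTC_Icc_real) (auto intro!: derivative_eq_intros continuous_intros)
  then show ?thesis
    using assms unfolding set_lebesgue_integral_def real_scaleR_def mult.commute[of "indicator _ _"]
    by (simp add: power_0_left)
qed

lemma hyp_weight_excess:
  assumes "k \<ge> 1"
  shows "2 * hyp_weight q k - 1
    = (LINT u:{0..1}|lborel. real k * (1 - u) ^ (k - 1) * ((1 - u / 2) powr (q - 1) - 1))"
proof -
  have "set_integrable lborel {0..1} (\<lambda>u. real k * (1 - u) ^ (k - 1) * (1 - u / 2) powr (q - 1))"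
    and "set_integrable lborel {0..1} (\<lambda>u. real k * (1 - u) ^ (k - 1))"
    by (intro borel_integrable_atLeastAtMost' continuous_intros; force)+
  then show ?thesis
    using integral_power_unit_interval[OF assms]
    by (simp add: hyp_weight_def right_diff_distrib set_integral_diff(2))
qed

section \<open>The signed location\<close>

definition erw_sign :: "(nat \<Rightarrow> 'a \<Rightarrow> bool) \<Rightarrow> nat \<Rightarrow> 'a \<Rightarrow> real" where
  "erw_sign g k \<omega> = (if g k \<omega> then 1 else - 1)"

lemma abs_erw_sign [simp]: "\<bar>erw_sign g k \<omega>\<bar> = 1"
  by (simp add: erw_sign_def)

lemma A_cnt_plus_B_cnt: "A_cnt g n \<omega> + B_cnt g n \<omega> = real n"
proof -
  have "card {k \<in> {1..n}. g k \<omega>} + card {k \<in> {1..n}. \<not> g k \<omega>}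
      = card ({k \<in> {1..n}. g k \<omega>} \<union> {k \<in> {1..n}. \<not> g k \<omega>})"
    by (intro card_Un_disjoint[symmetric]) auto
  also have "{k \<in> {1..n}. g k \<omega>} \<union> {k \<in> {1..n}. \<not> g k \<omega>} = {1..n}"
    by auto
  finally show ?thesis
    by (simp add: A_cnt_def B_cnt_def flip: of_nat_add)
qed

lemma W_erw_eq_sum: "W_erw g n \<omega> = (\<Sum>k<n. erw_sign g (Suc k) \<omega>)"
proof (induction n)
  case (Suc n)
  have "{k \<in> {1..Suc n}. P k} = (if P (Suc n) then {Suc n} else {}) \<union> {k \<in> {1..n}. P k}" for P
    by (auto simp: le_Suc_eq)
  with Suc show ?case
    by (simp add: W_erw_def A_cnt_def B_cnt_def erw_sign_def)
qed (simp add: W_erw_def A_cnt_def B_cnt_def)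

lemma alternating_hd_eq_last:
  assumes "successively (\<noteq>) w" "w \<noteq> []"
  shows "hd w = (if odd (length w) then last w else \<not> last w)"
  using assms
proof (induction w)
  case (Cons x w)
  then show ?case by (cases w) auto
qed simp

lemma successively_mul_gen: "successively (\<noteq>) w \<Longrightarrow> successively (\<noteq>) (mul_gen x w)"
  by (cases w) (auto simp: successively_Cons)

lemma even_length_mul_gen: "even (length (mul_gen x w)) = odd (length w)"
  by (cases w) auto

text \<open>
  The parity and the last letter of an alternating word determine its first letter, hence whether \<open>x\<close> cancels.
\<close>

lemma signed_loc_mul_gen:
  assumes "successively (\<noteq>) w"
  shows "signed_loc (mul_gen x w) = signed_loc w + (- 1) ^ length w * (if x then 1 else - 1)"
proof (cases w)
  case (Cons y ys)
  have "y = (if even (length ys) then last (y # ys) else \<not> last (y # ys))"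
    using alternating_hd_eq_last[OF assms] unfolding Cons by simp
  then show ?thesis
    using Cons by (cases "ys = []") (auto simp: signed_loc_def minus_one_power_iff split: if_splits)
qed (auto simp: signed_loc_def)

lemma Delta_s_eq_sum: "Delta_s g n \<omega> = (\<Sum>k<n. (- 1) ^ k * erw_sign g (Suc k) \<omega>)"
proof -
  have "successively (\<noteq>) (erw_word g n \<omega>) \<and> even (length (erw_word g n \<omega>)) = even n
      \<and> signed_loc (erw_word g n \<omega>) = (\<Sum>k<n. (- 1) ^ k * erw_sign g (Suc k) \<omega>)"
  proof (induction n)
    case (Suc n)
    then have "(- 1 :: real) ^ length (erw_word g n \<omega>) = (- 1) ^ n"
      by (simp add: minus_one_power_iff)
    moreover have "successively (\<noteq>) (mul_gen (g (Suc n) \<omega>) (erw_word g n \<omega>))"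
      using Suc by (blast intro: successively_mul_gen)
    ultimately show ?case
      using Suc by (simp add: even_length_mul_gen signed_loc_mul_gen erw_sign_def)
  qed (simp add: signed_loc_def)
  then show ?thesis by (simp add: Delta_s_def)
qed

section \<open>The elephant random walk\<close>

locale elephant_walk = prob_space M for M :: "'a measure" +
  fixes g :: "nat \<Rightarrow> 'a \<Rightarrow> bool" and p q :: real
  assumes p_range: "0 \<le> p" "p < 1"
    and q_def: "q = 2 * p - 1"
    and g_meas: "\<And>n. g n \<in> measurable M (count_space UNIV)"
    and g_first: "measure M {\<omega> \<in> space M. g 1 \<omega>} = 1 / 2"
    and g_step: "\<And>n A. n \<ge> 1 \<Longrightarrow> A \<in> sets (erw_filt M g n) \<Longrightarrow>
        measure M (A \<inter> {\<omega> \<in> space M. g (Suc n) \<omega>}) =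
        (LINT \<omega>:A|M. (p * A_cnt g n \<omega> + (1 - p) * B_cnt g n \<omega>) / real n)"
begin

abbreviation F :: "nat \<Rightarrow> 'a measure" where
  "F \<equiv> erw_filt M g"

abbreviation eps :: "nat \<Rightarrow> 'a \<Rightarrow> real" where
  "eps \<equiv> erw_sign g"

definition mean_step :: "nat \<Rightarrow> 'a \<Rightarrow> real" where
  "mean_step n \<omega> = W_erw g n \<omega> / real n"

definition innovation :: "nat \<Rightarrow> 'a \<Rightarrow> real" where
  "innovation n \<omega> = eps (Suc n) \<omega> - q * mean_step n \<omega>"

lemma q_bounds: "- 1 \<le> q" "q < 1" "\<bar>q\<bar> \<le> 1"
  using p_range q_def by auto

lemma step_event_sets [measurable]: "{\<omega> \<in> space M. g k \<omega>} \<in> sets M"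
  using g_meas[of k] by (simp add: pred_def)

lemma sets_F: "sets (F n) = sigma_sets (space M) {{\<omega> \<in> space M. g k \<omega>} | k. k \<in> {1..n}}"
  unfolding erw_filt_def by (rule sets_measure_of) auto

sublocale filtered_finite_measure M F
proof unfold_locales
  show "space (F n) = space M" for n
    unfolding erw_filt_def by (rule space_measure_of) auto
  show "sets (F m) \<subseteq> sets (F n)" if "m \<le> n" for m n
    unfolding sets_F using that by (intro sigma_sets_subseteq) auto
  show "sets (F n) \<subseteq> sets M" for n
    unfolding sets_F by (auto intro!: sets.sigma_sets_subset)
qed

lemma erw_sign_adapted:
  assumes "1 \<le> k" "k \<le> n"
  shows "eps k \<in> borel_measurable (F n)"
proof -
  have [measurable]: "{\<omega> \<in> space (F n). g k \<omega>} \<in> sets (F n)"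
    unfolding space_F sets_F using assms by (intro sigma_sets.Basic) auto
  show ?thesis
    unfolding erw_sign_def[abs_def] by measurable
qed

lemma erw_sign_measurable [measurable]: "eps k \<in> borel_measurable M"
  unfolding erw_sign_def[abs_def] by measurable

lemma integrable_erw_sign: "integrable M (eps k)"
  by (rule integrable_const_bound[of _ 1]) auto

lemma mean_step_0 [simp]: "mean_step 0 \<omega> = 0"
  by (simp add: mean_step_def)

lemma mean_step_adapted: "k \<le> n \<Longrightarrow> mean_step k \<in> borel_measurable (F n)"
  unfolding mean_step_def[abs_def] W_erw_eq_sum
  by (intro borel_measurable_divide borel_measurable_sum borel_measurable_const erw_sign_adapted) auto

lemma mean_step_measurable [measurable]: "mean_step n \<in> borel_measurable M"
  using mean_step_adapted[OF order_refl] by (rule borel_measurable_of_F)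

lemma abs_mean_step_le: "\<bar>mean_step n \<omega>\<bar> \<le> 1"
proof -
  have "\<bar>W_erw g n \<omega>\<bar> \<le> (\<Sum>k<n. \<bar>eps (Suc k) \<omega>\<bar>)"
    unfolding W_erw_eq_sum by (rule sum_abs)
  then show ?thesis by (cases "n = 0") (auto simp: mean_step_def field_simps)
qed

lemma integrable_mean_step: "integrable M (mean_step n)"
  by (rule integrable_const_bound[of _ 1]) (auto simp: abs_mean_step_le)

lemma square_integrable_mean_step: "integrable M (\<lambda>\<omega>. (mean_step n \<omega>)\<^sup>2)"
  by (rule integrable_const_bound[of _ 1]) (auto simp: abs_square_le_1 abs_mean_step_le)

lemma abs_innovation_le: "\<bar>innovation n \<omega>\<bar> \<le> 2"
proof -
  have "\<bar>q * mean_step n \<omega>\<bar> \<le> 1"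
    unfolding abs_mult using q_bounds(3) abs_mean_step_le[of n \<omega>] by (intro mult_le_one) auto
  then show ?thesis
    unfolding innovation_def using abs_erw_sign[of g "Suc n" \<omega>] by linarith
qed

lemma measure_step_event:
  assumes A: "A \<in> sets (F n)"
  shows "measure M (A \<inter> {\<omega> \<in> space M. g (Suc n) \<omega>}) = (LINT \<omega>:A|M. (1 + q * mean_step n \<omega>) / 2)"
proof (cases "n = 0")
  case True
  have "sets (F 0) = {{}, space M}"
    by (simp add: sets_F sigma_sets_empty_eq)
  then consider "A = {}" | "A = space M"
    using A True by auto
  then show ?thesis
  proof cases
    assume "A = space M"
    moreover have "space M \<inter> {\<omega> \<in> space M. g (Suc 0) \<omega>} = {\<omega> \<in> space M. g 1 \<omega>}"
      by auto
    ultimately show ?thesis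
      using True g_first by (simp add: prob_space set_lebesgue_integral_def)
  qed (simp add: set_lebesgue_integral_def)
next
  case False
  have "(p * A_cnt g n \<omega> + (1 - p) * B_cnt g n \<omega>) / real n = (1 + q * mean_step n \<omega>) / 2" for \<omega>
  proof -
    have "2 * (p * A_cnt g n \<omega> + (1 - p) * B_cnt g n \<omega>) = real n + q * W_erw g n \<omega>"
      unfolding A_cnt_plus_B_cnt[of g n \<omega>, symmetric] W_erw_def q_def by (simp add: algebra_simps)
    then show ?thesis
      using False by (simp add: mean_step_def field_simps)
  qed
  then show ?thesis
    using g_step[of n A] A False by (simp only:)
qed

lemma set_integral_erw_sign:
  assumes A: "A \<in> sets (F n)"
  shows "(LINT \<omega>:A|M. eps (Suc n) \<omega>) = (LINT \<omega>:A|M. q * mean_step n \<omega>)"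
proof -
  have AM [measurable]: "A \<in> sets M"
    using A sets_F_subset by blast
  have int: "set_integrable M A (\<lambda>_. 1 :: real)" "set_integrable M A (\<lambda>\<omega>. q * mean_step n \<omega>)"
    unfolding set_integrable_def
    by (intro integrable_mult_indicator AM Bochner_Integration.integrable_mult_right
        integrable_mean_step integrable_const)+
  have "(LINT \<omega>:A|M. eps (Suc n) \<omega>)
      = (\<integral>\<omega>. 2 * indicator (A \<inter> {\<omega> \<in> space M. g (Suc n) \<omega>}) \<omega> - indicator A \<omega> \<partial>M)"
    unfolding set_lebesgue_integral_def
    by (intro Bochner_Integration.integral_cong) (auto simp: erw_sign_def indicator_def)
  also have "\<dots> = 2 * measure M (A \<inter> {\<omega> \<in> space M. g (Suc n) \<omega>}) - measure M A"
    by (subst Bochner_Integration.integral_diff)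
       (auto simp: emeasure_eq_measure intro!: integrable_real_indicator)
  also have "2 * measure M (A \<inter> {\<omega> \<in> space M. g (Suc n) \<omega>}) = (LINT \<omega>:A|M. 1 + q * mean_step n \<omega>)"
    using measure_step_event[OF A] by simp
  also have "\<dots> = measure M A + (LINT \<omega>:A|M. q * mean_step n \<omega>)"
    using int by (simp only: set_integral_add) (simp add: set_lebesgue_integral_def)
  finally show ?thesis
    by simp
qed

lemma cond_exp_erw_sign: "AE \<omega> in M. real_cond_exp M (F n) (eps (Suc n)) \<omega> = q * mean_step n \<omega>"
  by (rule F.real_cond_exp_charact[OF set_integral_erw_sign])
     (auto intro: integrable_erw_sign integrable_mean_step intro!: borel_measurable_times mean_step_adapted)

sublocale innovation: martingale_differences M F innovation
proof unfold_locales
  show adapted: "innovation n \<in> borel_measurable (F (Suc n))" for n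
    unfolding innovation_def[abs_def]
    by (intro borel_measurable_diff borel_measurable_times borel_measurable_const
        erw_sign_adapted mean_step_adapted) auto
  have [measurable]: "innovation n \<in> borel_measurable M" for n
    using adapted by (rule borel_measurable_of_F)
  have "(innovation n \<omega>)\<^sup>2 \<le> 2\<^sup>2" for n \<omega>
    using power_mono[OF abs_innovation_le[of n \<omega>], of 2] by simp
  then show "integrable M (\<lambda>\<omega>. (innovation n \<omega>)\<^sup>2)" for n
    by (intro integrable_const_bound[of _ "2\<^sup>2"]) auto
  show "AE \<omega> in M. real_cond_exp M (F n) (innovation n) \<omega> = 0" for n
  proof -
    have "AE \<omega> in M. real_cond_exp M (F n) (innovation n) \<omega>
        = real_cond_exp M (F n) (eps (Suc n)) \<omega> - real_cond_exp M (F n) (\<lambda>\<omega>. q * mean_step n \<omega>) \<omega>"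
      unfolding innovation_def[abs_def]
      by (intro F.real_cond_exp_diff) (auto intro: integrable_erw_sign integrable_mean_step)
    moreover have "AE \<omega> in M. real_cond_exp M (F n) (\<lambda>\<omega>. q * mean_step n \<omega>) \<omega> = q * mean_step n \<omega>"
      by (intro F.real_cond_exp_F_meas)
         (auto intro: integrable_mean_step intro!: borel_measurable_times mean_step_adapted)
    ultimately show ?thesis
      using cond_exp_erw_sign[of n] by eventually_elim simp
  qed
qed

lemma innovation_sq:
  "(innovation n \<omega>)\<^sup>2 = 1 - q\<^sup>2 * (mean_step n \<omega>)\<^sup>2 - 2 * q * (mean_step n \<omega> * innovation n \<omega>)"
proof -
  have "(eps (Suc n) \<omega>)\<^sup>2 = 1"
    by (simp add: erw_sign_def)
  moreover have "eps (Suc n) \<omega> = innovation n \<omega> + q * mean_step n \<omega>"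
    by (simp add: innovation_def)
  ultimately show ?thesis
    by algebra
qed

lemma integrable_mean_step_mult_innovation: "integrable M (\<lambda>\<omega>. mean_step n \<omega> * innovation n \<omega>)"
  by (intro integrable_mult_of_square_integrable square_integrable_mean_step innovation.square_integrable) auto

lemma cond_exp_innovation_sq:
  "AE \<omega> in M. real_cond_exp M (F n) (\<lambda>\<omega>. (innovation n \<omega>)\<^sup>2) \<omega> = 1 - q\<^sup>2 * (mean_step n \<omega>)\<^sup>2"
proof -
  define C where "C \<omega> = 1 - q\<^sup>2 * (mean_step n \<omega>)\<^sup>2" for \<omega>
  have C: "integrable M C" "C \<in> borel_measurable (F n)"
    unfolding C_def[abs_def]
    using square_integrable_mean_step[of n] mean_step_adapted[OF order_refl, of n] by simp_all
  have sq: "(\<lambda>\<omega>. (innovation n \<omega>)\<^sup>2) = (\<lambda>\<omega>. C \<omega> - 2 * q * (mean_step n \<omega> * innovation n \<omega>))"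
    by (simp add: innovation_sq C_def fun_eq_iff)
  have "AE \<omega> in M. real_cond_exp M (F n) (\<lambda>\<omega>. (innovation n \<omega>)\<^sup>2) \<omega>
      = real_cond_exp M (F n) C \<omega> - real_cond_exp M (F n) (\<lambda>\<omega>. 2 * q * (mean_step n \<omega> * innovation n \<omega>)) \<omega>"
    unfolding sq by (intro F.real_cond_exp_diff C) (simp add: integrable_mean_step_mult_innovation)
  moreover have "AE \<omega> in M. real_cond_exp M (F n) C \<omega> = C \<omega>"
    by (intro F.real_cond_exp_F_meas C)
  moreover have "AE \<omega> in M. real_cond_exp M (F n) (\<lambda>\<omega>. 2 * q * (mean_step n \<omega> * innovation n \<omega>)) \<omega>
      = 2 * q * real_cond_exp M (F n) (\<lambda>\<omega>. mean_step n \<omega> * innovation n \<omega>) \<omega>"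
    by (intro F.real_cond_exp_cmult integrable_mean_step_mult_innovation)
  moreover have "AE \<omega> in M. real_cond_exp M (F n) (\<lambda>\<omega>. mean_step n \<omega> * innovation n \<omega>) \<omega>
      = mean_step n \<omega> * real_cond_exp M (F n) (innovation n) \<omega>"
    by (intro F.real_cond_exp_mult mean_step_adapted integrable_mean_step_mult_innovation) auto
  ultimately show ?thesis
    using innovation.cond_exp_eq_0[of n] by eventually_elim (simp add: C_def)
qed

subsection \<open>Decay of the mean step\<close>

definition mean_step_var :: "nat \<Rightarrow> real" where
  "mean_step_var n = (\<integral>\<omega>. (mean_step n \<omega>)\<^sup>2 \<partial>M)"

lemma mean_step_var_0 [simp]: "mean_step_var 0 = 0"
  by (simp add: mean_step_var_def)

lemma mean_step_var_nonneg: "0 \<le> mean_step_var n"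
  by (simp add: mean_step_var_def)

lemma innovation_second_moment: "(\<integral>\<omega>. (innovation n \<omega>)\<^sup>2 \<partial>M) = 1 - q\<^sup>2 * mean_step_var n"
proof -
  have "(\<integral>\<omega>. mean_step n \<omega> * innovation n \<omega> \<partial>M) = 0"
    by (intro innovation.integral_mult_eq_0 mean_step_adapted integrable_mean_step_mult_innovation order_refl)
  then show ?thesis
    unfolding innovation_sq using square_integrable_mean_step integrable_mean_step_mult_innovation
    by (simp add: mean_step_var_def prob_space)
qed

lemma mean_step_Suc_average: "mean_step (Suc n) \<omega> = (real n * mean_step n \<omega> + eps (Suc n) \<omega>) / (real n + 1)"
proof -
  have "W_erw g n \<omega> = real n * mean_step n \<omega>"
    by (cases "n = 0") (auto simp: mean_step_def W_erw_eq_sum)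
  then show ?thesis
    by (simp add: mean_step_def[of "Suc n"] W_erw_eq_sum add.commute)
qed

lemma mean_step_Suc:
  "mean_step (Suc n) \<omega> = (real n + q) / (real n + 1) * mean_step n \<omega> + 1 / (real n + 1) * innovation n \<omega>"
proof -
  have "mean_step (Suc n) \<omega> = ((real n + q) * mean_step n \<omega> + innovation n \<omega>) / (real n + 1)"
    unfolding mean_step_Suc_average by (simp add: innovation_def algebra_simps)
  then show ?thesis
    by (simp only: add_divide_distrib[of "_ * _"] times_divide_eq_left mult_1)
qed

lemma abs_mean_step_diff_le: "\<bar>mean_step (Suc n) \<omega> - mean_step n \<omega>\<bar> \<le> 2 / (real n + 1)"
proof -
  have "mean_step (Suc n) \<omega> - mean_step n \<omega> = (eps (Suc n) \<omega> - mean_step n \<omega>) / (real n + 1)"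
    unfolding mean_step_Suc_average by (simp add: field_simps)
  also have "\<bar>\<dots>\<bar> \<le> 2 / (real n + 1)"
    using abs_mean_step_le[of n \<omega>] abs_erw_sign[of g "Suc n" \<omega>]
    by (simp only: abs_divide) (intro divide_mono, linarith+)
  finally show ?thesis .
qed

lemma mean_step_var_Suc:
  "mean_step_var (Suc n)
    = ((real n + q) / (real n + 1))\<^sup>2 * mean_step_var n + (1 - q\<^sup>2 * mean_step_var n) / (real n + 1)\<^sup>2"
proof -
  have "mean_step_var (Suc n) = (\<integral>\<omega>. ((real n + q) / (real n + 1) * mean_step n \<omega>)\<^sup>2 \<partial>M)
      + (\<integral>\<omega>. (1 / (real n + 1) * innovation n \<omega>)\<^sup>2 \<partial>M)"
    unfolding mean_step_var_def mean_step_Suc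
    using mean_step_adapted[OF order_refl, of n] square_integrable_mean_step[of n]
    by (intro innovation.second_moment_add_mult(3)) (auto simp: power_mult_distrib power_divide)
  then show ?thesis
    by (simp add: power_mult_distrib power_divide innovation_second_moment flip: mean_step_var_def)
qed

lemma mean_step_var_Suc_le:
  "mean_step_var (Suc n) + (1 - q) * (mean_step_var n / (real n + 1)) \<le> mean_step_var n + 1 / (real n + 1)\<^sup>2"
proof (cases "n = 0")
  case False
  define r where "r = (real n + q) / (real n + 1)"
  have r: "0 \<le> r" "r \<le> 1" "1 - r = (1 - q) / (real n + 1)"
    using False q_bounds by (auto simp: r_def field_simps)
  have "r\<^sup>2 * mean_step_var n \<le> r * mean_step_var n"
    using r mean_step_var_nonneg[of n] by (intro mult_right_mono) (auto simp: power2_eq_square mult_left_le)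
  moreover have "(1 - q\<^sup>2 * mean_step_var n) / (real n + 1)\<^sup>2 \<le> 1 / (real n + 1)\<^sup>2"
    using mean_step_var_nonneg[of n] by (intro divide_right_mono) auto
  moreover have "(1 - q) * (mean_step_var n / (real n + 1)) = mean_step_var n - r * mean_step_var n"
    using arg_cong[OF r(3), of "\<lambda>z. z * mean_step_var n"] by (simp add: left_diff_distrib)
  ultimately show ?thesis
    unfolding mean_step_var_Suc r_def[symmetric] by linarith
qed (simp add: mean_step_var_Suc)

lemma summable_mean_step_var: "summable (\<lambda>n. mean_step_var n / (real n + 1))"
proof -
  have "summable (\<lambda>n. (1 - q) * (mean_step_var n / (real n + 1)))"
  proof (rule summableI_nonneg_bounded)
    show "0 \<le> (1 - q) * (mean_step_var n / (real n + 1))" for n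
      using q_bounds mean_step_var_nonneg[of n] by simp
    fix N
    have "(\<Sum>n<N. (1 - q) * (mean_step_var n / (real n + 1)))
        \<le> (\<Sum>n<N. mean_step_var n - mean_step_var (Suc n) + 1 / (real n + 1)\<^sup>2)"
      using mean_step_var_Suc_le by (intro sum_mono) (simp add: algebra_simps)
    also have "\<dots> = mean_step_var 0 - mean_step_var N + (\<Sum>n<N. 1 / (real n + 1)\<^sup>2)"
      by (simp only: sum.distrib sum_lessThan_telescope')
    also have "\<dots> \<le> (\<Sum>n. 1 / (real n + 1)\<^sup>2)"
      using mean_step_var_nonneg[of N] sum_le_suminf[OF summable_inverse_Suc_squares, of "{..<N}"] by simp
    finally show "(\<Sum>n<N. (1 - q) * (mean_step_var n / (real n + 1))) \<le> (\<Sum>n. 1 / (real n + 1)\<^sup>2)" .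
  qed
  then show ?thesis
    using q_bounds by (subst (asm) summable_cmult_iff) auto
qed

lemma mean_step_sq_tendsto_zero: "AE \<omega> in M. (\<lambda>n. (mean_step n \<omega>)\<^sup>2) \<longlonglongrightarrow> 0"
proof -
  have slow: "\<bar>(mean_step (Suc n) \<omega>)\<^sup>2 - (mean_step n \<omega>)\<^sup>2\<bar> \<le> 4 / (real n + 1)" for n \<omega>
  proof -
    have "\<bar>(mean_step (Suc n) \<omega>)\<^sup>2 - (mean_step n \<omega>)\<^sup>2\<bar>
        = \<bar>mean_step (Suc n) \<omega> - mean_step n \<omega>\<bar> * \<bar>mean_step (Suc n) \<omega> + mean_step n \<omega>\<bar>"
      by (simp add: power2_eq_square square_diff_square_factored abs_mult mult.commute)
    also have "\<dots> \<le> 2 / (real n + 1) * 2"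
      using abs_mean_step_diff_le[of n \<omega>] abs_mean_step_le[of n \<omega>] abs_mean_step_le[of "Suc n" \<omega>]
      by (intro mult_mono) auto
    finally show ?thesis by simp
  qed
  have "AE \<omega> in M. summable (\<lambda>n. (mean_step n \<omega>)\<^sup>2 / (real n + 1))"
  proof (rule AE_summable_of_summable_integral)
    show "summable (\<lambda>n. \<integral>\<omega>. (mean_step n \<omega>)\<^sup>2 / (real n + 1) \<partial>M)"
      using summable_mean_step_var by (simp add: mean_step_var_def)
  qed (auto intro: square_integrable_mean_step)
  then show ?thesis
    by eventually_elim (rule slowly_varying_tendsto_zero[OF _ slow], simp_all)
qed

lemma mean_step_tendsto_zero: "AE \<omega> in M. (\<lambda>n. mean_step n \<omega>) \<longlonglongrightarrow> 0"
  using mean_step_sq_tendsto_zero by eventually_elim simp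

lemma mean_step_var_tendsto_zero: "mean_step_var \<longlonglongrightarrow> 0"
proof -
  have "(\<lambda>n. \<integral>\<omega>. (mean_step n \<omega>)\<^sup>2 \<partial>M) \<longlonglongrightarrow> (\<integral>\<omega>. 0 \<partial>M)"
    by (rule integral_dominated_convergence[where w = "\<lambda>_. 1"])
       (auto simp: mean_step_tendsto_zero abs_square_le_1 abs_mean_step_le)
  then show ?thesis
    by (simp add: mean_step_var_def[abs_def])
qed

subsection \<open>The martingale part of the signed location\<close>

sublocale signed_innovation: martingale_differences M F "\<lambda>k \<omega>. (- 1) ^ k * innovation k \<omega>"
  by (rule innovation.martingale_differences_scale)

definition martingale_part :: "nat \<Rightarrow> 'a \<Rightarrow> real" where
  "martingale_part n \<omega> = (\<Sum>k<n. (- 1) ^ k * innovation k \<omega>)"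

lemma martingale_martingale_part: "is_martingale M F martingale_part"
  unfolding martingale_part_def[abs_def] by (rule signed_innovation.martingale_partial_sums)

lemma integral_martingale_part: "(\<integral>\<omega>. martingale_part n \<omega> \<partial>M) = 0"
  unfolding martingale_part_def by (simp add: innovation.integrable innovation.integral_eq_0)

lemma abs_martingale_part_diff_le: "\<bar>martingale_part (Suc n) \<omega> - martingale_part n \<omega>\<bar> \<le> 2"
  using abs_innovation_le[of n \<omega>] by (simp add: martingale_part_def abs_mult power_abs)

lemma pred_qv_martingale_part:
  "AE \<omega> in M. \<forall>n. pred_qv M F martingale_part n \<omega> = (\<Sum>k<n. 1 - q\<^sup>2 * (mean_step k \<omega>)\<^sup>2)"
proof -
  have pred_qv: "pred_qv M F martingale_part n \<omega>
      = (\<Sum>k<n. real_cond_exp M (F k) (\<lambda>\<omega>. (innovation k \<omega>)\<^sup>2) \<omega>)" for n \<omega>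
    by (simp add: pred_qv_def sum.atLeast1_atMost_eq martingale_part_def power_mult_distrib flip: power_mult)
  have "AE \<omega> in M. \<forall>k. real_cond_exp M (F k) (\<lambda>\<omega>. (innovation k \<omega>)\<^sup>2) \<omega> = 1 - q\<^sup>2 * (mean_step k \<omega>)\<^sup>2"
    unfolding AE_all_countable using cond_exp_innovation_sq by blast
  then show ?thesis
    by eventually_elim (simp add: pred_qv)
qed

lemma pred_qv_martingale_part_tendsto: "AE \<omega> in M. (\<lambda>n. pred_qv M F martingale_part n \<omega> / real n) \<longlonglongrightarrow> 1"
  using pred_qv_martingale_part mean_step_sq_tendsto_zero
proof eventually_elim
  case (elim \<omega>)
  have "(\<lambda>k. 1 - q\<^sup>2 * (mean_step k \<omega>)\<^sup>2) \<longlonglongrightarrow> 1 - q\<^sup>2 * 0"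
    using elim(2) by (intro tendsto_intros)
  from Cesaro_tendsto[OF this] show ?case
    by (simp add: elim(1) divide_inverse_commute)
qed

subsection \<open>The alternating sum as a martingale\<close>

abbreviation H :: "nat \<Rightarrow> real" where
  "H \<equiv> hyp_weight q"

definition alternating_coeff :: "nat \<Rightarrow> real" where
  "alternating_coeff k = (- 1) ^ Suc k * H (Suc k) / (real k + 1)"

sublocale weighted_innovation: martingale_differences M F "\<lambda>k \<omega>. alternating_coeff k * innovation k \<omega>"
  by (rule innovation.martingale_differences_scale)

lemma sum_alternating_mean_step:
  "(\<Sum>k<n. (- 1) ^ k * mean_step k \<omega>)
    = (\<Sum>k<n. alternating_coeff k * innovation k \<omega>) - (- 1) ^ n * H n * mean_step n \<omega>"
proof (induction n)
  case (Suc n)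
  define r where "r = (real n + q) / (real n + 1)"
  have weight: "H n * mean_step n \<omega> = (1 - r * H (Suc n)) * mean_step n \<omega>"
    by (cases "n = 0") (auto simp: r_def hyp_weight_recurrence[of n])
  have step: "mean_step (Suc n) \<omega> = r * mean_step n \<omega> + 1 / (real n + 1) * innovation n \<omega>"
    by (simp only: mean_step_Suc r_def)
  have "(\<Sum>k<Suc n. (- 1) ^ k * mean_step k \<omega>) = (\<Sum>k<n. alternating_coeff k * innovation k \<omega>)
      - (- 1) ^ n * (H n * mean_step n \<omega>) + (- 1) ^ n * mean_step n \<omega>"
    using Suc.IH by simp
  also have "\<dots> = (\<Sum>k<Suc n. alternating_coeff k * innovation k \<omega>)
      - (- 1) ^ Suc n * H (Suc n) * mean_step (Suc n) \<omega>"
    unfolding weight step by (simp add: alternating_coeff_def algebra_simps)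
  finally show ?case .
qed simp

lemma weighted_innovation_second_moment_le:
  "(\<integral>\<omega>. (alternating_coeff k * innovation k \<omega>)\<^sup>2 \<partial>M) \<le> 1 / (real k + 1)\<^sup>2"
proof -
  have "(alternating_coeff k)\<^sup>2 = (H (Suc k))\<^sup>2 / (real k + 1)\<^sup>2"
    by (simp add: alternating_coeff_def power_divide power_mult_distrib flip: power_mult)
  also have "\<dots> \<le> 1 / (real k + 1)\<^sup>2"
    using hyp_weight_nonneg hyp_weight_le_1 q_bounds by (intro divide_right_mono power_le_one) auto
  finally have "(alternating_coeff k)\<^sup>2 * (\<integral>\<omega>. (innovation k \<omega>)\<^sup>2 \<partial>M) \<le> 1 / (real k + 1)\<^sup>2 * 1"
    using mean_step_var_nonneg[of k]
    by (intro mult_mono Bochner_Integration.integral_nonneg) (auto simp: innovation_second_moment)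
  then show ?thesis
    by (simp add: power_mult_distrib)
qed

lemma summable_weighted_innovation: "summable (\<lambda>k. \<integral>\<omega>. (alternating_coeff k * innovation k \<omega>)\<^sup>2 \<partial>M)"
  by (rule summable_comparison_test'[OF summable_inverse_Suc_squares, of 0])
     (simp add: weighted_innovation_second_moment_le)

lemma abs_hyp_weight_mult_le: "\<bar>(- 1) ^ n * H n * x\<bar> \<le> \<bar>x\<bar>"
  using hyp_weight_nonneg[of q n] hyp_weight_le_1[OF q_bounds(1), of n]
  by (simp add: abs_mult power_abs mult_left_le_one_le)

lemma hyp_weight_mean_step_var_tendsto_zero: "(\<lambda>n. (H n)\<^sup>2 * mean_step_var n) \<longlonglongrightarrow> 0"
proof (rule tendsto_0_le[OF mean_step_var_tendsto_zero, of _ 1])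
  have "(H n)\<^sup>2 \<le> 1" for n
    using hyp_weight_nonneg hyp_weight_le_1 q_bounds by (simp add: power_le_one)
  then show "\<forall>\<^sub>F n in sequentially. norm ((H n)\<^sup>2 * mean_step_var n) \<le> norm (mean_step_var n) * 1"
    using mean_step_var_nonneg by (intro always_eventually allI) (simp add: abs_mult mult_left_le_one_le)
qed

definition alternating_sum :: "'a \<Rightarrow> real" where
  "alternating_sum \<omega> = (\<Sum>k. (- 1) ^ k * mean_step k \<omega>)"

lemma alternating_sum_measurable [measurable]: "alternating_sum \<in> borel_measurable M"
  unfolding alternating_sum_def[abs_def] by measurable

lemma alternating_sums_weighted_innovation:
  "AE \<omega> in M. (\<lambda>k. (- 1) ^ k * mean_step k \<omega>) sums (\<Sum>k. alternating_coeff k * innovation k \<omega>)"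
  using weighted_innovation.AE_summable[OF summable_weighted_innovation] mean_step_tendsto_zero
proof eventually_elim
  case (elim \<omega>)
  have "(\<lambda>n. (- 1) ^ n * H n * mean_step n \<omega>) \<longlonglongrightarrow> 0"
    by (rule tendsto_0_le[OF elim(2), of _ 1]) (simp add: abs_hyp_weight_mult_le)
  from tendsto_diff[OF summable_LIMSEQ[OF elim(1)] this] show ?case
    by (simp add: sums_def sum_alternating_mean_step)
qed

lemma alternating_sum_eq_weighted_innovation:
  "AE \<omega> in M. alternating_sum \<omega> = (\<Sum>k. alternating_coeff k * innovation k \<omega>)"
  using alternating_sums_weighted_innovation by eventually_elim (simp add: alternating_sum_def flip: sums_unique)

lemma alternating_mean_step_sums: "AE \<omega> in M. (\<lambda>k. (- 1) ^ k * mean_step k \<omega>) sums alternating_sum \<omega>"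
  using alternating_sums_weighted_innovation
  by eventually_elim (auto simp: alternating_sum_def intro: summable_sums sums_summable)

lemma square_integrable_alternating_sum: "integrable M (\<lambda>\<omega>. (alternating_sum \<omega>)\<^sup>2)"
proof (subst integrable_cong_AE)
  show "AE \<omega> in M. (alternating_sum \<omega>)\<^sup>2 = (\<Sum>k. alternating_coeff k * innovation k \<omega>)\<^sup>2"
    using alternating_sum_eq_weighted_innovation by eventually_elim simp
qed (auto intro: weighted_innovation.suminf_second_moment_le summable_weighted_innovation)

lemma integrable_alternating_sum: "integrable M alternating_sum"
  using square_integrable_imp_integrable[OF alternating_sum_measurable square_integrable_alternating_sum] .

lemma integral_alternating_sum: "(\<integral>\<omega>. alternating_sum \<omega> \<partial>M) = 0"
proof -
  have "(\<integral>\<omega>. alternating_sum \<omega> \<partial>M) = (\<integral>\<omega>. (\<Sum>k. alternating_coeff k * innovation k \<omega>) \<partial>M)"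
    using alternating_sum_eq_weighted_innovation by (intro integral_cong_AE) auto
  then show ?thesis
    using weighted_innovation.integral_suminf_eq_0[OF summable_weighted_innovation] by simp
qed

lemma alternating_sum_L2_tendsto:
  "(\<lambda>n. \<integral>\<omega>. ((\<Sum>k<n. (- 1) ^ k * mean_step k \<omega>) - alternating_sum \<omega>)\<^sup>2 \<partial>M) \<longlonglongrightarrow> 0"
proof -
  define D where "D n \<omega> = (\<Sum>k<n. alternating_coeff k * innovation k \<omega>)
      - (\<Sum>k. alternating_coeff k * innovation k \<omega>)" for n \<omega>
  define R where "R n \<omega> = (- 1) ^ n * H n * mean_step n \<omega>" for n \<omega>
  have [measurable]: "D n \<in> borel_measurable M" "R n \<in> borel_measurable M" for n
    unfolding D_def[abs_def] R_def[abs_def] by measurable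
  have "AE \<omega> in M. ((\<Sum>k<n. (- 1) ^ k * mean_step k \<omega>) - alternating_sum \<omega>)\<^sup>2 = (D n \<omega> - R n \<omega>)\<^sup>2" for n
    using alternating_sum_eq_weighted_innovation
  proof eventually_elim
    case (elim \<omega>)
    have "(\<Sum>k<n. (- 1) ^ k * mean_step k \<omega>) - alternating_sum \<omega> = D n \<omega> - R n \<omega>"
      unfolding elim sum_alternating_mean_step D_def R_def by linarith
    then show ?case
      by (simp only:)
  qed
  then have "(\<integral>\<omega>. ((\<Sum>k<n. (- 1) ^ k * mean_step k \<omega>) - alternating_sum \<omega>)\<^sup>2 \<partial>M)
      = (\<integral>\<omega>. (D n \<omega> - R n \<omega>)\<^sup>2 \<partial>M)" for n
    by (intro integral_cong_AE) auto
  moreover have "(\<lambda>n. \<integral>\<omega>. (D n \<omega> - R n \<omega>)\<^sup>2 \<partial>M) \<longlonglongrightarrow> 0"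
  proof (rule tendsto_L2_diff)
    show "integrable M (\<lambda>\<omega>. (D n \<omega>)\<^sup>2)" for n
      unfolding D_def using summable_weighted_innovation
      by (intro square_integrable_diff weighted_innovation.suminf_second_moment_le
          weighted_innovation.partial_sum_second_moment) auto
    show "integrable M (\<lambda>\<omega>. (R n \<omega>)\<^sup>2)" for n
      using square_integrable_mean_step by (simp add: R_def power_mult_distrib)
    show "(\<lambda>n. \<integral>\<omega>. (D n \<omega>)\<^sup>2 \<partial>M) \<longlonglongrightarrow> 0"
      unfolding D_def by (rule weighted_innovation.L2_tendsto_suminf[OF summable_weighted_innovation])
    have "(\<integral>\<omega>. (R n \<omega>)\<^sup>2 \<partial>M) = (H n)\<^sup>2 * mean_step_var n" for n
      by (simp add: R_def power_mult_distrib mean_step_var_def flip: power_mult)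
    then show "(\<lambda>n. \<integral>\<omega>. (R n \<omega>)\<^sup>2 \<partial>M) \<longlonglongrightarrow> 0"
      by (simp add: hyp_weight_mean_step_var_tendsto_zero)
  qed auto
  ultimately show ?thesis
    by simp
qed

subsection \<open>The second moment of the limit\<close>

lemma sum_weighted_innovation_second_moment:
  "(\<Sum>k<n. \<integral>\<omega>. (alternating_coeff k * innovation k \<omega>)\<^sup>2 \<partial>M)
    = (H n)\<^sup>2 * mean_step_var n + (\<Sum>k<n. mean_step_var k * (2 * H k - 1))"
proof (induction n)
  case (Suc n)
  define r where "r = (real n + q) / (real n + 1)"
  define e where "e = (1 - q\<^sup>2 * mean_step_var n) / (real n + 1)\<^sup>2"
  have "mean_step_var (Suc n) = r\<^sup>2 * mean_step_var n + e"
    by (simp only: mean_step_var_Suc r_def e_def)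
  moreover have "(\<integral>\<omega>. (alternating_coeff n * innovation n \<omega>)\<^sup>2 \<partial>M) = (H (Suc n))\<^sup>2 * e"
    by (simp add: alternating_coeff_def power_divide power_mult_distrib innovation_second_moment e_def
        flip: power_mult)
  moreover have "mean_step_var n * H n = mean_step_var n * (1 - r * H (Suc n))"
    by (cases "n = 0") (auto simp: r_def hyp_weight_recurrence[of n])
  ultimately show ?case
    using Suc.IH unfolding sum.lessThan_Suc by algebra
qed simp

lemma alternating_sum_second_moment_sums:
  "(\<lambda>k. mean_step_var k * (2 * H k - 1)) sums (\<integral>\<omega>. (alternating_sum \<omega>)\<^sup>2 \<partial>M)"
proof -
  have "(\<integral>\<omega>. (alternating_sum \<omega>)\<^sup>2 \<partial>M) = (\<integral>\<omega>. (\<Sum>k. alternating_coeff k * innovation k \<omega>)\<^sup>2 \<partial>M)"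
    using alternating_sum_eq_weighted_innovation by (intro integral_cong_AE) (auto elim: eventually_mono)
  then have total: "(\<lambda>n. (H n)\<^sup>2 * mean_step_var n + (\<Sum>k<n. mean_step_var k * (2 * H k - 1)))
      \<longlonglongrightarrow> (\<integral>\<omega>. (alternating_sum \<omega>)\<^sup>2 \<partial>M)"
    using weighted_innovation.second_moment_suminf_sums[OF summable_weighted_innovation]
    by (simp only: sums_def sum_weighted_innovation_second_moment)
  from tendsto_diff[OF total hyp_weight_mean_step_var_tendsto_zero] show ?thesis
    by (simp add: sums_def)
qed

lemma alternating_sum_second_moment_integral:
  assumes K: "\<And>u. 0 < u \<Longrightarrow> u < 1 \<Longrightarrow> (\<lambda>k. real k * mean_step_var k * (1 - u) ^ k) sums K u"
  shows "(\<integral>\<omega>. (alternating_sum \<omega>)\<^sup>2 \<partial>M)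
    = (LINT u:{0<..<1}|lborel. K u / (1 - u) * ((1 - u / 2) powr (q - 1) - 1))"
proof -
  define f where "f k u = mean_step_var k * (real k * (1 - u) ^ (k - 1) * ((1 - u / 2) powr (q - 1) - 1))"
    for k and u :: real
  have integral: "(LINT u:{0<..<1}|lborel. f k u) = mean_step_var k * (2 * H k - 1)" for k
  proof (cases "k = 0")
    case False
    have "(LINT u:{0<..<1}|lborel. f k u) = (LINT u:{0..1}|lborel. f k u)"
      by (rule set_integral_discrete_difference[where X = "{0, 1}"]) auto
    also have "\<dots> = mean_step_var k * (2 * H k - 1)"
      using hyp_weight_excess[of k q] False by (simp only: f_def set_integral_mult_right)
    finally show ?thesis .
  qed (simp add: f_def set_lebesgue_integral_def)
  have "(\<lambda>k. LINT u:{0<..<1}|lborel. f k u)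
      sums (LINT u:{0<..<1}|lborel. K u / (1 - u) * ((1 - u / 2) powr (q - 1) - 1))"
  proof (rule sums_set_integral_nonneg)
    have "set_integrable lborel {0..1} (f k)" for k
      unfolding f_def[abs_def] by (intro borel_integrable_atLeastAtMost' continuous_intros) auto
    then show "set_integrable lborel {0<..<1} (f k)" for k
      by (rule set_integrable_subset) auto
    show "0 \<le> f k u" if "u \<in> {0<..<1}" for k u
      using powr_mono2'[of "q - 1" "1 - u / 2" 1] mean_step_var_nonneg[of k] q_bounds that by (simp add: f_def)
    show "(\<lambda>k. f k u) sums (K u / (1 - u) * ((1 - u / 2) powr (q - 1) - 1))" if "u \<in> {0<..<1}" for u
    proof -
      have "f k u = real k * mean_step_var k * (1 - u) ^ k / (1 - u) * ((1 - u / 2) powr (q - 1) - 1)" for k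
        using that by (cases k) (auto simp: f_def)
      then show ?thesis
        using that by (simp only:) (intro sums_mult2 sums_divide K, auto)
    qed
    show "summable (\<lambda>k. LINT u:{0<..<1}|lborel. f k u)"
      using alternating_sum_second_moment_sums by (simp only: integral sums_summable)
  qed
  then show ?thesis
    unfolding integral by (rule sums_unique2[OF alternating_sum_second_moment_sums])
qed

lemma mean_step_var_recurrence:
  "real (Suc n) * (real (Suc n) * mean_step_var (Suc n)) = 1 + (real n + 2 * q) * (real n * mean_step_var n)"
proof -
  have "(real n + 1)\<^sup>2 * mean_step_var (Suc n) = (real n + q)\<^sup>2 * mean_step_var n + (1 - q\<^sup>2 * mean_step_var n)"
    by (simp add: mean_step_var_Suc distrib_left power_divide)
  then show ?thesis
    by (simp add: power2_eq_square algebra_simps)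
qed

lemma alternating_sum_second_moment_generic:
  assumes "q \<noteq> 1 / 2"
  shows "(\<integral>\<omega>. (alternating_sum \<omega>)\<^sup>2 \<partial>M) = 1 / (2 * q - 1) * (LINT u:{0<..<1}|lborel.
      (u powr (- 2 * q + 1) - 1) / (1 - u) * (((1 - u / 2) powr (q - 1) - 1) / u))"
proof -
  have closed: "real k * mean_step_var k = (pochhammer (2 * q) k / fact k - 1) / (2 * q - 1)" for k
    using mean_step_var_recurrence assms by (intro affine_recurrence_pochhammer) auto
  have "(\<lambda>k. real k * mean_step_var k * (1 - u) ^ k) sums ((u powr (- 2 * q + 1) - 1) / u / (2 * q - 1))"
    if u: "0 < u" "u < 1" for u
  proof -
    have "(\<lambda>k. pochhammer (2 * q) k / fact k * (1 - u) ^ k) sums (1 - (1 - u)) powr (- (2 * q))"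
      using u by (intro pochhammer_series) auto
    moreover have "(\<lambda>k. (1 - u) ^ k) sums (1 / (1 - (1 - u)))"
      using u by (intro geometric_sums) auto
    ultimately have "(\<lambda>k. (pochhammer (2 * q) k / fact k * (1 - u) ^ k - (1 - u) ^ k) / (2 * q - 1)) sums
        (((1 - (1 - u)) powr (- (2 * q)) - 1 / (1 - (1 - u))) / (2 * q - 1))"
      by (intro sums_divide sums_diff)
    moreover have "u powr (- 2 * q + 1) = u powr (- 2 * q) * u"
      using u by (subst powr_add) simp
    then have "u powr (- 2 * q) - 1 / u = (u powr (- 2 * q + 1) - 1) / u"
      using u by (simp add: diff_divide_distrib)
    ultimately show ?thesis
      by (simp add: closed left_diff_distrib)
  qed
  then have "(\<integral>\<omega>. (alternating_sum \<omega>)\<^sup>2 \<partial>M) = (LINT u:{0<..<1}|lborel.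
      (u powr (- 2 * q + 1) - 1) / u / (2 * q - 1) / (1 - u) * ((1 - u / 2) powr (q - 1) - 1))"
    by (rule alternating_sum_second_moment_integral)
  also have "\<dots> = (LINT u:{0<..<1}|lborel. 1 / (2 * q - 1) *
      ((u powr (- 2 * q + 1) - 1) / (1 - u) * (((1 - u / 2) powr (q - 1) - 1) / u)))"
    by (intro arg_cong[where f = "set_lebesgue_integral lborel {0<..<1}"] ext) (simp add: mult_ac)
  also have "\<dots> = 1 / (2 * q - 1) * (LINT u:{0<..<1}|lborel.
      (u powr (- 2 * q + 1) - 1) / (1 - u) * (((1 - u / 2) powr (q - 1) - 1) / u))"
    by (rule set_integral_mult_right)
  finally show ?thesis .
qed

lemma alternating_sum_second_moment_half:
  assumes "q = 1 / 2"
  shows "(\<integral>\<omega>. (alternating_sum \<omega>)\<^sup>2 \<partial>M) = (LINT u:{0<..<1}|lborel.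
      (- ln u) / (1 - u) * (((1 - u / 2) powr (- 1 / 2) - 1) / u))"
proof -
  have closed: "real k * mean_step_var k = harm k" for k
    using mean_step_var_recurrence assms by (intro affine_recurrence_harm) auto
  have "(\<lambda>k. real k * mean_step_var k * (1 - u) ^ k) sums (- ln u / u)" if "0 < u" "u < 1" for u
    using harm_series[of "1 - u"] that by (simp add: closed)
  then have "(\<integral>\<omega>. (alternating_sum \<omega>)\<^sup>2 \<partial>M)
      = (LINT u:{0<..<1}|lborel. - ln u / u / (1 - u) * ((1 - u / 2) powr (q - 1) - 1))"
    by (rule alternating_sum_second_moment_integral)
  also have "q - 1 = - 1 / 2"
    using assms by simp
  finally show ?thesis
    by (simp add: mult_ac)
qed

subsection \<open>The predictable part of the signed location\<close>

definition predictable_part :: "nat \<Rightarrow> 'a \<Rightarrow> real" where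
  "predictable_part n \<omega> = q * (\<Sum>k<n. (- 1) ^ k * mean_step k \<omega>)"

lemma predictable_part_eq: "predictable_part n \<omega> = q * (\<Sum>k\<in>{1..<n}. (- 1) ^ k * W_erw g k \<omega> / real k)"
proof -
  have "(\<Sum>k\<in>{1..<n}. (- 1) ^ k * mean_step k \<omega>) = (\<Sum>k<n. (- 1) ^ k * mean_step k \<omega>)"
    by (rule sum.mono_neutral_left) (auto simp: not_less_eq_eq)
  then show ?thesis
    by (simp add: predictable_part_def mean_step_def)
qed

lemma Delta_s_decomposition: "Delta_s g n \<omega> = martingale_part n \<omega> + predictable_part n \<omega>"
proof -
  have "martingale_part n \<omega> + predictable_part n \<omega> = (\<Sum>k<n. (- 1) ^ k * (innovation k \<omega> + q * mean_step k \<omega>))"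
    by (simp add: martingale_part_def predictable_part_def sum_distrib_left sum.distrib[symmetric]
        algebra_simps)
  then show ?thesis
    by (simp add: Delta_s_eq_sum innovation_def)
qed

lemma predictable_part_predictable: "predictable_part (Suc n) \<in> borel_measurable (F n)"
  unfolding predictable_part_def[abs_def]
  by (intro borel_measurable_times borel_measurable_sum borel_measurable_const mean_step_adapted) auto

lemma predictable_part_tendsto: "AE \<omega> in M. (\<lambda>n. predictable_part n \<omega>) \<longlonglongrightarrow> q * alternating_sum \<omega>"
  using alternating_mean_step_sums
  by eventually_elim (auto simp: predictable_part_def sums_def intro: tendsto_mult_left)

lemma predictable_part_L2_tendsto: "(\<lambda>n. \<integral>\<omega>. (predictable_part n \<omega> - q * alternating_sum \<omega>)\<^sup>2 \<partial>M) \<longlonglongrightarrow> 0"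
  using tendsto_mult_right_zero[OF alternating_sum_L2_tendsto, of "q\<^sup>2"]
  by (simp add: predictable_part_def power_mult_distrib flip: right_diff_distrib)

lemma predictable_limit_second_moment:
  "(LINT \<omega>|M. (q * alternating_sum \<omega>)\<^sup>2) =
    (if q \<noteq> 1 / 2 then
       q\<^sup>2 / (2 * q - 1) *
       (LINT u:{0<..<1}|lborel.
          (u powr (- 2 * q + 1) - 1) / (1 - u) * (((1 - u / 2) powr (q - 1) - 1) / u))
     else
       1 / 4 *
       (LINT u:{0<..<1}|lborel.
          (- ln u) / (1 - u) * (((1 - u / 2) powr (- 1 / 2) - 1) / u)))"
proof (cases "q = 1 / 2")
  case True
  have "q\<^sup>2 = 1 / 4"
    unfolding True by (simp add: power_divide)
  with True show ?thesis
    using alternating_sum_second_moment_half[OF True] by (simp add: power_mult_distrib)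
next
  case False
  then show ?thesis
    using alternating_sum_second_moment_generic[OF False] by (simp add: power_mult_distrib)
qed

end

theorem theorem2p2:
  fixes M :: "'a measure" and g :: "nat \<Rightarrow> 'a \<Rightarrow> bool" and p q :: real
  assumes P: "prob_space M"
    and p_range: "0 \<le> p" "p < 1"
    and q_def: "q = 2 * p - 1"
    and g_meas: "\<And>n. g n \<in> measurable M (count_space UNIV)"
    and g_first: "measure M {\<omega> \<in> space M. g 1 \<omega>} = 1 / 2"
    and g_step: "\<And>n A. n \<ge> 1 \<Longrightarrow> A \<in> sets (erw_filt M g n) \<Longrightarrow>
        measure M (A \<inter> {\<omega> \<in> space M. g (Suc n) \<omega>}) =
        (LINT \<omega>:A|M. (p * A_cnt g n \<omega> + (1 - p) * B_cnt g n \<omega>) / real n)"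
  shows "\<exists>\<Xi> :: nat \<Rightarrow> 'a \<Rightarrow> real.
     is_martingale M (erw_filt M g) \<Xi>
   \<and> (\<forall>n. (LINT \<omega>|M. \<Xi> n \<omega>) = 0)
   \<and> (\<exists>C. \<forall>n. \<forall>\<omega>\<in>space M. \<bar>\<Xi> (Suc n) \<omega> - \<Xi> n \<omega>\<bar> \<le> C)
   \<and> (AE \<omega> in M. (\<lambda>n. pred_qv M (erw_filt M g) \<Xi> n \<omega> / real n) \<longlonglongrightarrow> 1)
   \<and> (\<forall>n. \<forall>\<omega>\<in>space M. Delta_s g n \<omega> =
          \<Xi> n \<omega> + q * (\<Sum>k\<in>{1..<n}. (-1) ^ k * W_erw g k \<omega> / real k))
   \<and> (let Z = (\<lambda>n \<omega>. Delta_s g n \<omega> - \<Xi> n \<omega>);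
          Zinf = (\<lambda>\<omega>. q * (\<Sum>k. (-1) ^ k * W_erw g k \<omega> / real k))
      in (\<forall>n. Z (Suc n) \<in> borel_measurable (erw_filt M g n))
       \<and> (AE \<omega> in M. summable (\<lambda>k. (-1) ^ k * W_erw g k \<omega> / real k))
       \<and> (AE \<omega> in M. (\<lambda>n. Z n \<omega>) \<longlonglongrightarrow> Zinf \<omega>)
       \<and> Zinf \<in> borel_measurable M
       \<and> integrable M Zinf
       \<and> integrable M (\<lambda>\<omega>. (Zinf \<omega>)\<^sup>2)
       \<and> (\<lambda>n. LINT \<omega>|M. (Z n \<omega> - Zinf \<omega>)\<^sup>2) \<longlonglongrightarrow> 0
       \<and> (LINT \<omega>|M. Zinf \<omega>) = 0
       \<and> (LINT \<omega>|M. (Zinf \<omega>)\<^sup>2) =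
           (if q \<noteq> 1 / 2 then
              q\<^sup>2 / (2 * q - 1) *
              (LINT u:{0<..<1}|lborel.
                 (u powr (- 2 * q + 1) - 1) / (1 - u) * (((1 - u / 2) powr (q - 1) - 1) / u))
            else
              1 / 4 *
              (LINT u:{0<..<1}|lborel.
                 (- ln u) / (1 - u) * (((1 - u / 2) powr (- 1 / 2) - 1) / u))))"
proof -
  interpret prob_space M by (rule P)
  interpret elephant_walk M g p q
    by unfold_locales (fact p_range q_def g_meas g_first g_step)+
  have summand: "(- 1) ^ k * W_erw g k \<omega> / real k = (- 1) ^ k * mean_step k \<omega>" for k \<omega>
    by (simp add: mean_step_def)
  have Z: "Delta_s g n \<omega> - martingale_part n \<omega> = predictable_part n \<omega>" for n \<omega>
    by (simp add: Delta_s_decomposition)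
  have summable: "AE \<omega> in M. summable (\<lambda>k. (- 1) ^ k * mean_step k \<omega>)"
    using alternating_mean_step_sums by eventually_elim (rule sums_summable)
  have limit: "(\<lambda>\<omega>. q * alternating_sum \<omega>) \<in> borel_measurable M"
    "integrable M (\<lambda>\<omega>. q * alternating_sum \<omega>)" "integrable M (\<lambda>\<omega>. (q * alternating_sum \<omega>)\<^sup>2)"
    "(LINT \<omega>|M. q * alternating_sum \<omega>) = 0"
    using integrable_alternating_sum square_integrable_alternating_sum
    by (simp_all add: power_mult_distrib integral_alternating_sum)
  show ?thesis
    unfolding Let_def predictable_part_eq[symmetric]
    by (rule exI[of _ martingale_part], unfold Z summand alternating_sum_def[symmetric])
       (intro conjI allI ballI exI[of _ 2] martingale_martingale_part integral_martingale_part
         abs_martingale_part_diff_le pred_qv_martingale_part_tendsto Delta_s_decomposition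
         predictable_part_predictable summable predictable_part_tendsto limit predictable_part_L2_tendsto predictable_limit_second_moment)
qed

end
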